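(* Let $G$ be an algebraic group over a non-Archimedean local field $\mathbb{F}$. Suppose $P_k$ is surjective on $G(\mathbb{F})$ for all $k\in\mathbb{N}$, $k\geq 1$. Then $G(\mathbb{F})$ is unipotent. If in addition the characteristic of $\mathbb{F}$ is positive, then $G(\mathbb{F})=\{e\}$.
   Context: Algebraic groups over $\mathbb{F}$ are smooth affine $\mathbb{F}$-groups. $P_k\colon G(\mathbb{F})\to G(\mathbb{F})$ is the power map $P_k(x)=x^k$. *)

theory Defs
  imports
    "HOL-Analysis.Analysis"
    "HOL-Library.Poly_Mapping"
    "HOL-Algebra.Group"
begin

section \<open>Non-Archimedean local fields\<close>

text \<open>
  A field that is complete for a (nontrivial) discrete ultrametric absolute value and has finite
  residue field. The residue field is the quotient of the valuation ring \<open>v x \<le> 1\<close> by its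
  maximal ideal \<open>v x < 1\<close>.
\<close>

locale nonarch_local_field =
  fixes v :: "'a::field \<Rightarrow> real"
  assumes nonneg: "v x \<ge> 0"
    and eq_0_iff: "v x = 0 \<longleftrightarrow> x = 0"
    and mult: "v (x * y) = v x * v y"
    and ultrametric: "v (x + y) \<le> max (v x) (v y)"
    and discrete: "\<exists>\<pi>. 0 < v \<pi> \<and> v \<pi> < 1 \<and> (\<forall>x. x \<noteq> 0 \<longrightarrow> (\<exists>n::int. v x = v \<pi> powi n))"
    and complete: "Metric_space.mcomplete UNIV (\<lambda>x y. v (x - y))"
    and finite_residue_field:
      "finite ({x. v x \<le> 1} // {(x, y). v x \<le> 1 \<and> v y \<le> 1 \<and> v (x - y) < 1})"


section \<open>Multivariate polynomials\<close>

text \<open>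
  The polynomial ring with coefficients in \<open>'a\<close> and variables indexed by \<open>'v\<close>, as the monoid
  algebra on the monomials \<open>'v \<Rightarrow>\<^sub>0 nat\<close>.
\<close>

type_synonym ('v, 'a) mpoly = "('v \<Rightarrow>\<^sub>0 nat) \<Rightarrow>\<^sub>0 'a"

definition Const :: "'a::zero \<Rightarrow> ('v, 'a) mpoly" where
  "Const c = Poly_Mapping.single 0 c"

definition Var :: "'v \<Rightarrow> ('v, 'a::zero_neq_one) mpoly" where
  "Var i = Poly_Mapping.single (Poly_Mapping.single i 1) 1"

definition mpoly_eval :: "('a::zero \<Rightarrow> 'b::comm_ring_1) \<Rightarrow> ('v \<Rightarrow> 'b) \<Rightarrow> ('v, 'a) mpoly \<Rightarrow> 'b" where
  "mpoly_eval \<phi> x f =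
     (\<Sum>m\<in>Poly_Mapping.keys f. \<phi> (Poly_Mapping.lookup f m) *
        (\<Prod>i\<in>Poly_Mapping.keys m. x i ^ Poly_Mapping.lookup m i))"

abbreviation eval_at :: "('v \<Rightarrow> 'a::comm_ring_1) \<Rightarrow> ('v, 'a) mpoly \<Rightarrow> 'a" where
  "eval_at \<equiv> mpoly_eval (\<lambda>c. c)"

abbreviation subst_poly ::
  "('v \<Rightarrow> ('w, 'a::comm_ring_1) mpoly) \<Rightarrow> ('v, 'a) mpoly \<Rightarrow> ('w, 'a) mpoly" where
  "subst_poly \<equiv> mpoly_eval Const"

abbreviation rename_vars :: "('v \<Rightarrow> 'w) \<Rightarrow> ('v, 'a::comm_ring_1) mpoly \<Rightarrow> ('w, 'a) mpoly" where
  "rename_vars r \<equiv> subst_poly (\<lambda>i. Var (r i))"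

definition pderiv_var :: "'v \<Rightarrow> ('v, 'a::comm_ring_1) mpoly \<Rightarrow> ('v, 'a) mpoly" where
  "pderiv_var i f =
     (\<Sum>m\<in>Poly_Mapping.keys f.
        Poly_Mapping.single (m - Poly_Mapping.single i 1)
          (of_nat (Poly_Mapping.lookup m i) * Poly_Mapping.lookup f m))"

text \<open>Ideals of a commutative ring are the submodules of the ring over itself.\<close>

abbreviation ring_ideal :: "'r::comm_ring_1 set \<Rightarrow> bool" where
  "ring_ideal \<equiv> module.subspace (*)"

abbreviation ideal_gen :: "'r::comm_ring_1 set \<Rightarrow> 'r set" where
  "ideal_gen \<equiv> module.span (*)"

definition prime_ideal :: "'r::comm_ring_1 set \<Rightarrow> bool" where
  "prime_ideal P \<longleftrightarrow>
     ring_ideal P \<and> P \<noteq> UNIV \<and> (\<forall>a b. a * b \<in> P \<longrightarrow> a \<in> P \<or> b \<in> P)"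


section \<open>Affine group schemes of finite type\<close>

text \<open>
  An affine group scheme of finite type over the field \<open>'a\<close>, presented as a closed subscheme
  \<open>Spec ('a['v] / I)\<close> of the affine space with coordinates \<open>'v\<close> (finite). By the Yoneda lemma
  a morphism to affine space is a tuple of elements of the coordinate ring, so multiplication and
  inversion are given by tuples of polynomials, and the identity section by a rational point. The
  ideal is part of the data: it need not be radical, and identities between morphisms are
  congruences of polynomials rather than identities on rational points.
\<close>

record (overloaded) ('v, 'a) affine_gs =
  ideal_of :: "('v, 'a) mpoly set"
  mu :: "'v \<Rightarrow> ('v + 'v, 'a) mpoly"
  unt :: "'v \<Rightarrow> 'a"
  iota :: "'v \<Rightarrow> ('v, 'a) mpoly"

text \<open>
  The ideals of \<open>G \<times> G\<close> and \<open>G \<times> G \<times> G\<close>, i.e. the kernels of the maps from the polynomial rings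
  onto the twofold and threefold tensor powers of the coordinate ring.
\<close>

definition ideal2 :: "('v, 'a::comm_ring_1) affine_gs \<Rightarrow> ('v + 'v, 'a) mpoly set" where
  "ideal2 G = ideal_gen (rename_vars Inl ` ideal_of G \<union> rename_vars Inr ` ideal_of G)"

definition ideal3 :: "('v, 'a::comm_ring_1) affine_gs \<Rightarrow> ('v + 'v + 'v, 'a) mpoly set" where
  "ideal3 G = ideal_gen (rename_vars Inl ` ideal_of G \<union>
     rename_vars (Inr \<circ> Inl) ` ideal_of G \<union> rename_vars (Inr \<circ> Inr) ` ideal_of G)"

text \<open>The product of two points with coordinates in an arbitrary polynomial ring.\<close>

definition poly_mult ::
  "('v, 'a::comm_ring_1) affine_gs \<Rightarrow> ('v \<Rightarrow> ('w, 'a) mpoly) \<Rightarrow> ('v \<Rightarrow> ('w, 'a) mpoly) \<Rightarrow>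
     'v \<Rightarrow> ('w, 'a) mpoly" where
  "poly_mult G x y = (\<lambda>i. subst_poly (case_sum x y) (mu G i))"

locale affine_group_scheme =
  fixes G :: "('v::finite, 'a::field) affine_gs"
  assumes ideal: "ring_ideal (ideal_of G)"
    and mu_welldef: "f \<in> ideal_of G \<Longrightarrow> subst_poly (mu G) f \<in> ideal2 G"
    and unit_welldef: "f \<in> ideal_of G \<Longrightarrow> eval_at (unt G) f = 0"
    and iota_welldef: "f \<in> ideal_of G \<Longrightarrow> subst_poly (iota G) f \<in> ideal_of G"
    and assoc:
      "poly_mult G (poly_mult G (Var \<circ> Inl) (Var \<circ> Inr \<circ> Inl)) (Var \<circ> Inr \<circ> Inr) i
       - poly_mult G (Var \<circ> Inl) (poly_mult G (Var \<circ> Inr \<circ> Inl) (Var \<circ> Inr \<circ> Inr)) i \<in> ideal3 G"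
    and left_unit: "poly_mult G (Const \<circ> unt G) Var i - Var i \<in> ideal_of G"
    and right_unit: "poly_mult G Var (Const \<circ> unt G) i - Var i \<in> ideal_of G"
    and left_inverse: "poly_mult G (iota G) Var i - Const (unt G i) \<in> ideal_of G"
    and right_inverse: "poly_mult G Var (iota G) i - Const (unt G i) \<in> ideal_of G"

text \<open>
  Smoothness of \<open>Spec ('a['v] / I)\<close> at every point \<open>P\<close>: locally at \<open>P\<close> the ideal \<open>I\<close> is
  generated by finitely many elements of \<open>I\<close> whose differentials are linearly independent at
  \<open>P\<close>. Linear independence over the residue field at \<open>P\<close> is expressed with coefficients in the
  domain \<open>'a['v] / P\<close>, of which the residue field is the field of fractions.
\<close>

definition smooth_ideal :: "('v::finite, 'a::field) mpoly set \<Rightarrow> bool" where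
  "smooth_ideal I \<longleftrightarrow>
     (\<forall>P. prime_ideal P \<and> I \<subseteq> P \<longrightarrow>
        (\<exists>S. finite S \<and> S \<subseteq> I \<and>
           (\<forall>h\<in>I. \<exists>g. g \<notin> P \<and> g * h \<in> ideal_gen S) \<and>
           (\<forall>a. (\<forall>i. (\<Sum>s\<in>S. a s * pderiv_var i s) \<in> P) \<longrightarrow> (\<forall>s\<in>S. a s \<in> P))))"

locale algebraic_group = affine_group_scheme G
  for G :: "('v::finite, 'a::field) affine_gs" +
  assumes smooth: "smooth_ideal (ideal_of G)"


section \<open>Rational points and unipotent elements\<close>

definition rational_points :: "('v, 'a::field) affine_gs \<Rightarrow> ('v \<Rightarrow> 'a) monoid" where
  "rational_points G =
     \<lparr> carrier = {x. \<forall>f\<in>ideal_of G. eval_at x f = 0},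
       monoid.mult = (\<lambda>x y i. eval_at (case_sum x y) (mu G i)),
       one = unt G \<rparr>"

text \<open>Right translation \<open>(\<rho>\<^sub>g f) x = f (x g)\<close> on regular functions, on polynomial representatives.\<close>

definition right_translation ::
  "('v, 'a::field) affine_gs \<Rightarrow> ('v \<Rightarrow> 'a) \<Rightarrow> ('v, 'a) mpoly \<Rightarrow> ('v, 'a) mpoly" where
  "right_translation G g f = subst_poly (poly_mult G Var (Const \<circ> g)) f"

text \<open>
  As in the theory of the Jordan decomposition, \<open>g\<close> is unipotent if right translation by \<open>g\<close> is a
  locally unipotent operator on the coordinate ring \<open>'a['v] / I\<close>.
\<close>

definition unipotent_element :: "('v, 'a::field) affine_gs \<Rightarrow> ('v \<Rightarrow> 'a) \<Rightarrow> bool" where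
  "unipotent_element G g \<longleftrightarrow>
     g \<in> carrier (rational_points G) \<and>
     (\<forall>f. \<exists>n. ((\<lambda>h. right_translation G g h - h) ^^ n) f \<in> ideal_of G)"

definition unipotent_points :: "('v, 'a::field) affine_gs \<Rightarrow> bool" where
  "unipotent_points G \<longleftrightarrow> (\<forall>g\<in>carrier (rational_points G). unipotent_element G g)"

definition power_map :: "('v, 'a::field) affine_gs \<Rightarrow> nat \<Rightarrow> ('v \<Rightarrow> 'a) \<Rightarrow> ('v \<Rightarrow> 'a)" where
  "power_map G k x = x [^]\<^bsub>rational_points G\<^esub> k"

end

theory Submission
  imports Defs "Jordan_Normal_Form.Char_Poly"
begin

text \<open>
  Write \<open>F\<close> for the local field, \<open>O\<close> for its valuation ring and \<open>\<pi>\<close> for a uniformizer. Right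
  translation makes \<open>G(F)\<close> act on the coordinate ring \<open>F[G]\<close>, and this action is locally finite.
  So a regular function \<open>f\<close> lies in a finite-dimensional invariant subspace, on which \<open>G(F)\<close> acts
  through a group \<open>H\<close> of \<open>n \<times> n\<close> matrices in which every element has roots of all orders. It suffices
  to show that such a group consists of unipotent matrices
  (\<open>divisible_matrix_group_unipotent\<close>). The size \<open>n\<close> depends on \<open>f\<close> but not on the element of \<open>G(F)\<close>.

  Let \<open>T\<close> be in \<open>H\<close>. If \<open>R\<close> is a root of \<open>T\<close> of high order, then the powers of \<open>R\<close> grow so slowly that,
  the valuation being discrete, \<open>R\<close> stabilises an \<open>O\<close>-lattice in \<open>F\<^sup>n\<close>; so does \<open>T\<close>, a power of \<open>R\<close>
  (\<open>root_stabilises_lattice\<close>). In a basis of its lattice, each element of \<open>H\<close> becomes a matrix over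
  \<open>O\<close>, and applying this to inverses shows that its determinant is a unit. Since \<open>O\<close> modulo
  \<open>\<pi>\<^sup>j\<close> is finite, there is one exponent \<open>k\<close> such that the \<open>k\<close>-th power of every matrix in \<open>GL\<^sub>n(O)\<close> is
  congruent to \<open>1\<close> modulo \<open>\<pi>\<^sup>j\<close> (\<open>uniform_power_near_one\<close>). Writing \<open>T\<close> as such a \<open>k\<close>-th power of an
  element of \<open>H\<close> shows that \<open>T - 1\<close> is similar to a matrix that vanishes modulo \<open>\<pi>\<^sup>j\<close>. The lattice
  changes with \<open>j\<close>, but the characteristic polynomial of \<open>T - 1\<close> does not. Its coefficients below
  the leading one are therefore zero, and \<open>T - 1\<close> is nilpotent.

  In characteristic \<open>p > 0\<close> the binomial expansion of \<open>(1 + (T - 1))\<^sup>k\<close> collapses to \<open>1\<close> for a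
  suitable \<open>k\<close> that depends only on the nilpotency degree. Taking for \<open>f\<close> the finitely many coordinate
  functions gives one \<open>k\<close> with \<open>g\<^sup>k = e\<close> for all rational points \<open>g\<close>. The power map \<open>P\<^sub>k\<close> is then both
  constant and surjective, so \<open>G(F)\<close> is trivial.
\<close>

hide_const (open) Determinants.det Finite_Cartesian_Product.vec Finite_Cartesian_Product.mat
  Finite_Cartesian_Product.row Finite_Cartesian_Product.column
no_notation Finite_Cartesian_Product.vec_nth (infixl "$" 90)
no_notation Finite_Cartesian_Product.vector_scalar_mult (infixl "*s" 70)


section \<open>Discrete valuations\<close>

context nonarch_local_field
begin

lemma v_0 [simp]: "v 0 = 0"
  by (simp add: eq_0_iff)

lemma v_pos: "x \<noteq> 0 \<Longrightarrow> 0 < v x"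
  using nonneg[of x] eq_0_iff[of x] by linarith

lemma v_1 [simp]: "v 1 = 1"
  using mult[of 1 1] eq_0_iff[of 1] by simp

lemma v_minus_1 [simp]: "v (- 1) = 1"
proof -
  have "(v (- 1))\<^sup>2 = 1"
    using mult[of "- 1" "- 1"] by (simp add: power2_eq_square)
  then show ?thesis
    using nonneg[of "- 1"] by (simp add: power2_eq_1_iff)
qed

lemma v_minus [simp]: "v (- x) = v x"
  using mult[of "- 1" x] by simp

lemma v_power: "v (x ^ n) = v x ^ n"
  by (induction n) (simp_all add: mult)

lemma v_prod: "v (prod f A) = (\<Prod>i\<in>A. v (f i))"
  by (induction A rule: infinite_finite_induct) (simp_all add: mult)

lemma v_add_le: "v x \<le> b \<Longrightarrow> v y \<le> b \<Longrightarrow> v (x + y) \<le> b"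
  using ultrametric[of x y] by simp

lemma v_diff_le: "v x \<le> b \<Longrightarrow> v y \<le> b \<Longrightarrow> v (x - y) \<le> b"
  using v_add_le[of x b "- y"] by simp

lemma v_sum_le:
  assumes "0 \<le> b" and "\<And>i. i \<in> A \<Longrightarrow> v (f i) \<le> b"
  shows "v (sum f A) \<le> b"
  using assms by (induction A rule: infinite_finite_induct) (simp_all add: v_add_le)

lemma v_mult_le: "v x \<le> a \<Longrightarrow> v y \<le> b \<Longrightarrow> v (x * y) \<le> a * b"
  by (simp add: mult mult_mono nonneg order_trans[OF nonneg])

definition uniformizer :: 'a where
  "uniformizer = (SOME \<pi>. 0 < v \<pi> \<and> v \<pi> < 1 \<and> (\<forall>x. x \<noteq> 0 \<longrightarrow> (\<exists>n::int. v x = v \<pi> powi n)))"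

lemma uniformizer: "0 < v uniformizer" "v uniformizer < 1"
  "x \<noteq> 0 \<Longrightarrow> \<exists>n::int. v x = v uniformizer powi n"
  using someI_ex[OF discrete, folded uniformizer_def] by blast+

lemma uniformizer_nonzero [simp]: "uniformizer \<noteq> 0"
  using uniformizer(1) by auto

lemma v_less_imp_le_uniformizer:
  assumes "v x < v y"
  shows "v x \<le> v uniformizer * v y"
proof (cases "x = 0")
  case True
  then show ?thesis by (simp add: nonneg)
next
  case False
  let ?q = "v uniformizer"
  have "y \<noteq> 0" using assms nonneg[of x] by auto
  then obtain m n :: int where mn: "v x = ?q powi m" "v y = ?q powi n"
    using uniformizer(3) False by blast
  have "n < m"
  proof (rule ccontr)
    assume "\<not> n < m"
    then have "?q powi n \<le> ?q powi m"
      using uniformizer(1,2) by (intro power_int_decreasing) auto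
    with assms mn show False by simp
  qed
  then have "?q powi m \<le> ?q powi (1 + n)"
    using uniformizer(1,2) by (intro power_int_decreasing) auto
  also have "\<dots> = ?q * ?q powi n"
    using uniformizer(1) by (simp add: power_int_add)
  finally show ?thesis using mn by simp
qed

text \<open>Without a largest value there would be a strictly increasing sequence of values. Each step
  multiplies the value by at least \<open>1 / v \<pi>\<close>, so such a sequence is unbounded.\<close>

lemma v_image_has_max:
  assumes "X \<noteq> {}" and bound: "\<And>x. x \<in> X \<Longrightarrow> v (f x) \<le> b"
  shows "\<exists>x\<in>X. \<forall>y\<in>X. v (f y) \<le> v (f x)"
proof (rule ccontr)
  assume "\<not> ?thesis"
  then have less: "\<forall>x\<in>X. \<exists>y\<in>X. v (f x) < v (f y)" by (auto simp: not_le)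
  let ?q = "v uniformizer"
  have *: "\<exists>x\<in>X. 0 < v (f x) \<and> v (f x0) \<le> ?q ^ n * v (f x)" if "x0 \<in> X" "0 < v (f x0)" for n x0
  proof (induction n)
    case 0
    show ?case using that by auto
  next
    case (Suc n)
    then obtain x where x: "x \<in> X" "0 < v (f x)" "v (f x0) \<le> ?q ^ n * v (f x)" by blast
    with less obtain y where y: "y \<in> X" "v (f x) < v (f y)" by blast
    have "?q ^ n * v (f x) \<le> ?q ^ n * (?q * v (f y))"
      using v_less_imp_le_uniformizer[OF y(2)] uniformizer(1) by (intro mult_left_mono) auto
    with x y show ?case by (intro bexI[of _ y]) (auto simp: algebra_simps)
  qed
  obtain x1 where "x1 \<in> X" using assms(1) by blast
  with less obtain x0 where x0: "x0 \<in> X" "v (f x1) < v (f x0)" by blast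
  then have pos: "0 < v (f x0)" using nonneg[of "f x1"] by linarith
  have "b > 0" using bound[OF x0(1)] pos by linarith
  then have "\<exists>n. ?q ^ n < v (f x0) / b"
    using pos uniformizer(1,2) by (intro real_arch_pow_inv) auto
  then obtain n where n: "?q ^ n * b < v (f x0)"
    using \<open>b > 0\<close> by (auto simp: field_simps)
  obtain x where x: "x \<in> X" "v (f x0) \<le> ?q ^ n * v (f x)"
    using *[OF x0(1) pos] by blast
  have "?q ^ n * v (f x) \<le> ?q ^ n * b"
    using bound[OF x(1)] uniformizer(1) by (intro mult_left_mono) auto
  with n x show False by simp
qed

text \<open>The finiteness of \<open>O / \<pi>\<^sup>j O\<close>, in terms of representatives: if the residue field is represented by
  \<open>S\<close> and \<open>O / \<pi>\<^sup>j O\<close> by \<open>R\<close>, then the sums \<open>r + \<pi>\<^sup>j s\<close> represent the classes modulo \<open>\<pi>\<^bsup>j+1\<^esup>\<close>.\<close>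

lemma finite_net:
  "\<exists>R. finite R \<and> (\<forall>x. v x \<le> 1 \<longrightarrow> (\<exists>r\<in>R. v (x - r) \<le> v uniformizer ^ j))"
proof (induction j)
  case 0
  show ?case by (intro exI[of _ "{0}"]) auto
next
  case (Suc j)
  let ?q = "v uniformizer"
  obtain R where R: "finite R" "\<And>x. v x \<le> 1 \<Longrightarrow> \<exists>r\<in>R. v (x - r) \<le> ?q ^ j"
    using Suc by blast
  define Q where "Q = {x. v x \<le> 1} // {(x, y). v x \<le> 1 \<and> v y \<le> 1 \<and> v (x - y) < 1}"
  define S where "S = (\<lambda>C. SOME x. x \<in> C) ` Q"
  have fin: "finite S" unfolding S_def Q_def using finite_residue_field by blast
  have S: "\<exists>s\<in>S. v (x - s) \<le> ?q" if "v x \<le> 1" for x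
  proof -
    let ?C = "{(x, y). v x \<le> 1 \<and> v y \<le> 1 \<and> v (x - y) < 1} `` {x}"
    let ?s = "SOME y. y \<in> ?C"
    have "?C \<in> Q" unfolding Q_def using that by (intro quotientI) auto
    then have "?s \<in> S" unfolding S_def by (rule imageI)
    moreover have "x \<in> ?C" using that by auto
    then have "?s \<in> ?C" by (rule someI)
    then have "v (x - ?s) < v 1" by auto
    then have "v (x - ?s) \<le> ?q"
      using v_less_imp_le_uniformizer[of "x - ?s" 1] by simp
    ultimately show ?thesis by blast
  qed
  show ?case
  proof (intro exI conjI allI impI)
    show "finite ((\<lambda>(r, s). r + uniformizer ^ j * s) ` (R \<times> S))" using R(1) fin by auto
    fix x assume "v x \<le> 1"
    then obtain r where r: "r \<in> R" "v (x - r) \<le> ?q ^ j" using R(2) by blast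
    define y where "y = (x - r) / uniformizer ^ j"
    have y: "x - r = uniformizer ^ j * y" unfolding y_def by simp
    then have "?q ^ j * v y \<le> ?q ^ j * 1" using r(2) by (simp add: mult v_power)
    then have "v y \<le> 1" using uniformizer(1) by simp
    then obtain s where s: "s \<in> S" "v (y - s) \<le> ?q" using S by blast
    have "x - (r + uniformizer ^ j * s) = uniformizer ^ j * (y - s)"
      using y by (simp add: algebra_simps)
    then have "v (x - (r + uniformizer ^ j * s)) = ?q ^ j * v (y - s)"
      by (simp only: mult v_power)
    also have "\<dots> \<le> ?q ^ Suc j" using s(2) uniformizer(1) by simp
    finally show "\<exists>t\<in>(\<lambda>(r, s). r + uniformizer ^ j * s) ` (R \<times> S). v (x - t) \<le> ?q ^ Suc j"
      using r s by (intro bexI[of _ "r + uniformizer ^ j * s"]) auto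
  qed
qed

end

section \<open>Matrices with bounded entries\<close>

lemma pow_mat_add:
  assumes "(A :: 'b :: semiring_1 mat) \<in> carrier_mat n n"
  shows "A ^\<^sub>m (a + b) = A ^\<^sub>m a * A ^\<^sub>m b"
  using assms by (induction b) (auto simp: assoc_mult_mat[of _ n n _ n _ n])

lemma pow_mat_mult:
  assumes "(A :: 'b :: semiring_1 mat) \<in> carrier_mat n n"
  shows "A ^\<^sub>m (a * b) = (A ^\<^sub>m a) ^\<^sub>m b"
  using assms by (induction b) (auto simp: pow_mat_add[OF assms] add.commute[of a])

context nonarch_local_field
begin

definition entries_le :: "real \<Rightarrow> nat \<Rightarrow> 'a mat \<Rightarrow> bool" where
  "entries_le b n A \<longleftrightarrow> A \<in> carrier_mat n n \<and> (\<forall>i<n. \<forall>j<n. v (A $$ (i, j)) \<le> b)"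

lemma entries_le_carrier: "entries_le b n A \<Longrightarrow> A \<in> carrier_mat n n"
  by (simp add: entries_le_def)

lemma entries_leD: "entries_le b n A \<Longrightarrow> i < n \<Longrightarrow> j < n \<Longrightarrow> v (A $$ (i, j)) \<le> b"
  by (simp add: entries_le_def)

lemma entries_le_mono: "entries_le a n A \<Longrightarrow> a \<le> b \<Longrightarrow> entries_le b n A"
  unfolding entries_le_def by force

lemma entries_le_exists:
  assumes "A \<in> carrier_mat n n"
  shows "\<exists>b\<ge>1. entries_le b n A"
proof (intro exI conjI)
  let ?b = "Max (insert 1 ((\<lambda>(i, j). v (A $$ (i, j))) ` ({..<n} \<times> {..<n})))"
  show "1 \<le> ?b" by (rule Max_ge) auto
  show "entries_le ?b n A"
    unfolding entries_le_def using assms by (auto intro!: Max_ge)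
qed

lemma entries_le_add:
  assumes "entries_le b n A" "entries_le b n B"
  shows "entries_le b n (A + B)"
  using assms unfolding entries_le_def by (auto intro!: v_add_le)

lemma entries_le_mult:
  assumes "entries_le a n A" "entries_le b n B" "0 \<le> a" "0 \<le> b"
  shows "entries_le (a * b) n (A * B)"
  using assms unfolding entries_le_def
  by (auto simp: scalar_prod_def intro!: v_sum_le v_mult_le)

lemma entries_le_one: "entries_le 1 n (1\<^sub>m n)"
  by (auto simp: entries_le_def)

lemma entries_le_pow:
  assumes "entries_le b n A" "0 \<le> b"
  shows "entries_le (b ^ k) n (A ^\<^sub>m k)"
proof (induction k)
  case 0
  then show ?case using entries_le_one assms(1) by (auto simp: entries_le_def)
next
  case (Suc k)
  then show ?case
    using entries_le_mult[OF Suc assms(1)] assms(2) by (simp add: mult.commute)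
qed

lemma entries_le_1_pow: "entries_le 1 n A \<Longrightarrow> entries_le 1 n (A ^\<^sub>m k)"
  using entries_le_pow[of 1 n A k] by simp

lemma v_det_le:
  assumes "entries_le b n A" "0 \<le> b"
  shows "v (det A) \<le> b ^ n"
proof -
  have "v (of_int (sign p) * (\<Prod>i = 0..<n. A $$ (i, p i))) \<le> b ^ n" if "p permutes {0..<n}" for p
  proof -
    have "(\<Prod>i = 0..<n. v (A $$ (i, p i))) \<le> (\<Prod>i = 0..<n. b)"
      using assms that by (intro prod_mono) (auto simp: entries_le_def nonneg permutes_in_image)
    moreover have "v (of_int (sign p)) = 1" by (cases "evenperm p") (auto simp: sign_def)
    ultimately show ?thesis by (simp add: mult v_prod)
  qed
  then show ?thesis
    using assms by (auto simp: det_def'[OF entries_le_carrier] intro!: v_sum_le)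
qed

text \<open>The inverse is the adjugate divided by the determinant. The adjugate consists of minors, which
  are integral, and the determinant is a unit.\<close>

lemma integral_inverse:
  assumes "entries_le 1 n A" "v (det A) = 1"
  shows "\<exists>C. entries_le 1 n C \<and> C * A = 1\<^sub>m n"
proof -
  note A = entries_le_carrier[OF assms(1)]
  have d: "det A \<noteq> 0" using assms(2) by auto
  have "v (cofactor A j i) \<le> 1" if "i < n" "j < n" for i j
  proof -
    have "entries_le 1 (n - 1) (mat_delete A j i)"
      unfolding entries_le_def using mat_delete_carrier[OF A]
      using assms(1) that by (auto simp: mat_delete_def entries_le_def)
    from v_det_le[OF this] show ?thesis by (simp add: cofactor_def mult v_power)
  qed
  then have "entries_le 1 n (adj_mat A)"
    using A by (auto simp: entries_le_def adj_mat_def)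
  moreover have "v (inverse (det A)) = 1"
    using mult[of "det A" "inverse (det A)"] d assms(2) by simp
  ultimately have "entries_le 1 n (inverse (det A) \<cdot>\<^sub>m adj_mat A)"
    by (auto simp: entries_le_def mult)
  moreover have "inverse (det A) \<cdot>\<^sub>m adj_mat A * A = 1\<^sub>m n"
  proof -
    have "inverse (det A) \<cdot>\<^sub>m adj_mat A * A = inverse (det A) \<cdot>\<^sub>m (det A \<cdot>\<^sub>m 1\<^sub>m n)"
      using adj_mat[OF A] A by (simp add: mult_smult_assoc_mat[of _ n n _ n])
    also have "\<dots> = 1\<^sub>m n" using d by (intro eq_matI) auto
    finally show ?thesis .
  qed
  ultimately show ?thesis by blast
qed

text \<open>The reductions of \<open>GL\<^sub>n(O)\<close> modulo a power of \<open>\<pi>\<close> form a finite group. Pigeonhole bounds the orders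
  of its elements by one number \<open>N\<close>, and then \<open>N!\<close> is a common exponent.\<close>

lemma uniform_power_near_one:
  assumes "0 < c"
  shows "\<exists>k\<ge>1. \<forall>A. entries_le 1 n A \<and> v (det A) = 1 \<longrightarrow> entries_le c n (A ^\<^sub>m k - 1\<^sub>m n)"
proof -
  have "\<exists>j. v uniformizer ^ j < c"
    using assms uniformizer by (intro real_arch_pow_inv) auto
  then obtain j where j: "v uniformizer ^ j < c" ..
  obtain R where R: "finite R" "\<And>x. v x \<le> 1 \<Longrightarrow> \<exists>r\<in>R. v (x - r) \<le> v uniformizer ^ j"
    using finite_net by blast
  \<comment> \<open>Rounding the entries to representatives modulo \<open>\<pi>\<^sup>j\<close> plays the role of reduction; \<open>\<Phi>\<close> contains
    all rounded integral matrices.\<close>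
  define rd where "rd x = (SOME r. r \<in> R \<and> v (x - r) \<le> v uniformizer ^ j)" for x
  have rd: "rd x \<in> R" "v (x - rd x) \<le> c" if "v x \<le> 1" for x
    using someI_ex[of "\<lambda>r. r \<in> R \<and> v (x - r) \<le> v uniformizer ^ j"] R(2)[OF that] j
    unfolding rd_def by force+
  define \<Phi> where "\<Phi> = PiE ({..<n} \<times> {..<n}) (\<lambda>_. R)"
  have fin: "finite \<Phi>" unfolding \<Phi>_def using R(1) by (intro finite_PiE) auto
  define F where "F A = restrict (\<lambda>ij. rd (A $$ ij)) ({..<n} \<times> {..<n})" for A
  have F: "F A \<in> \<Phi>" if "entries_le 1 n A" for A
    using that rd(1) by (auto simp: F_def \<Phi>_def entries_le_def)
  show ?thesis
  proof (intro exI[of _ "fact (card \<Phi>)"] conjI allI impI)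
    show "(1::nat) \<le> fact (card \<Phi>)" by simp
    fix A assume "entries_le 1 n A \<and> v (det A) = 1"
    then have int: "entries_le 1 n A" and d: "v (det A) = 1" by auto
    note A [simp] = entries_le_carrier[OF int]
    have "card ((\<lambda>a. F (A ^\<^sub>m a)) ` {..card \<Phi>}) \<le> card \<Phi>"
      using fin F entries_le_1_pow[OF int] by (intro card_mono) auto
    then have "\<not> inj_on (\<lambda>a. F (A ^\<^sub>m a)) {..card \<Phi>}"
      by (intro pigeonhole) simp
    then obtain a b where ab: "a < b" "b \<le> card \<Phi>" "F (A ^\<^sub>m a) = F (A ^\<^sub>m b)"
      unfolding inj_on_def by (metis atMost_iff linorder_neqE_nat)
    have close: "entries_le c n (A ^\<^sub>m b - A ^\<^sub>m a)"
      unfolding entries_le_def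
    proof (intro conjI allI impI)
      fix i k assume ik: "i < n" "k < n"
      have "rd ((A ^\<^sub>m a) $$ (i, k)) = rd ((A ^\<^sub>m b) $$ (i, k))"
        using fun_cong[OF ab(3), of "(i, k)"] ik by (simp add: F_def)
      moreover have "v ((A ^\<^sub>m e) $$ (i, k) - rd ((A ^\<^sub>m e) $$ (i, k))) \<le> c" for e
        using rd(2) entries_leD[OF entries_le_1_pow[OF int] ik] .
      ultimately have "v (((A ^\<^sub>m b) $$ (i, k) - rd ((A ^\<^sub>m b) $$ (i, k))) -
          ((A ^\<^sub>m a) $$ (i, k) - rd ((A ^\<^sub>m b) $$ (i, k)))) \<le> c"
        by (metis v_diff_le)
      then show "v ((A ^\<^sub>m b - A ^\<^sub>m a) $$ (i, k)) \<le> c"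
        using ik carrier_matD[OF pow_carrier_mat[OF A]] by simp
    qed (use minus_carrier_mat[OF pow_carrier_mat[OF A]] in blast)
    define e where "e = b - a"
    obtain C where C: "entries_le 1 n C" "C * A = 1\<^sub>m n" using integral_inverse[OF int d] by blast
    note [simp] = entries_le_carrier[OF C(1)]
    have Ca: "C ^\<^sub>m l * A ^\<^sub>m l = 1\<^sub>m n" for l
    proof (induction l)
      case (Suc l)
      have "A ^\<^sub>m Suc l = A * A ^\<^sub>m l" using pow_mat_add[OF A, of 1 l] by simp
      then have "C ^\<^sub>m Suc l * A ^\<^sub>m Suc l = (C ^\<^sub>m l * C) * (A * A ^\<^sub>m l)" by simp
      also have "\<dots> = C ^\<^sub>m l * (C * (A * A ^\<^sub>m l))"
        using mult_carrier_mat[OF A pow_carrier_mat[OF A]]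
        by (intro assoc_mult_mat[of _ n n _ n _ n]) auto
      also have "C * (A * A ^\<^sub>m l) = (C * A) * A ^\<^sub>m l"
        by (intro assoc_mult_mat[of _ n n _ n _ n, symmetric]) auto
      finally show ?case using Suc C(2) left_mult_one_mat[OF pow_carrier_mat[OF A]] by simp
    qed (use carrier_matD[OF A] carrier_matD[OF entries_le_carrier[OF C(1)]] in simp)
    \<comment> \<open>\<open>A\<^sup>a\<close> and \<open>A\<^sup>b\<close> are congruent; cancel \<open>A\<^sup>a\<close> with the integral inverse.\<close>
    have "C ^\<^sub>m a * (A ^\<^sub>m b - A ^\<^sub>m a) = A ^\<^sub>m e - 1\<^sub>m n"
    proof -
      have "A ^\<^sub>m b = A ^\<^sub>m a * A ^\<^sub>m e" using ab(1) pow_mat_add[OF A, of a e] by (simp add: e_def)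
      then have "C ^\<^sub>m a * A ^\<^sub>m b = A ^\<^sub>m e"
        using Ca[of a] left_mult_one_mat[OF pow_carrier_mat[OF A]]
        by (simp add: assoc_mult_mat[of _ n n _ n _ n, symmetric])
      then show ?thesis using Ca[of a] by (simp add: mult_minus_distrib_mat[of _ n n _ n])
    qed
    then have e: "entries_le c n (A ^\<^sub>m e - 1\<^sub>m n)"
      using entries_le_mult[OF entries_le_1_pow[OF C(1)] close, of a] assms by simp
    have "entries_le c n (A ^\<^sub>m (e * l) - 1\<^sub>m n)" for l
    proof (induction l)
      case 0
      then show ?case using assms carrier_matD[OF A] by (auto simp: entries_le_def)
    next
      case (Suc l)
      have "A ^\<^sub>m (e * Suc l) - 1\<^sub>m n = A ^\<^sub>m e * (A ^\<^sub>m (e * l) - 1\<^sub>m n) + (A ^\<^sub>m e - 1\<^sub>m n)"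
      proof -
        have "A ^\<^sub>m e * (A ^\<^sub>m (e * l) - 1\<^sub>m n) = A ^\<^sub>m (e * Suc l) - A ^\<^sub>m e"
          using right_mult_one_mat[OF pow_carrier_mat[OF A]]
          by (simp add: mult_minus_distrib_mat[of _ n n _ n] pow_mat_add[OF A])
        then show ?thesis using carrier_matD[OF A] by (intro eq_matI) auto
      qed
      moreover have "entries_le c n (A ^\<^sub>m e * (A ^\<^sub>m (e * l) - 1\<^sub>m n))"
        using entries_le_mult[OF entries_le_1_pow[OF int] Suc, of e] assms by simp
      ultimately show ?case
        using entries_le_add[OF _ e] by simp
    qed
    moreover have "e dvd fact (card \<Phi>)" using ab unfolding e_def by (intro dvd_fact) auto
    ultimately show "entries_le c n (A ^\<^sub>m fact (card \<Phi>) - 1\<^sub>m n)" by (auto elim!: dvdE)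
  qed
qed

end

section \<open>Lattices\<close>

context nonarch_local_field
begin

definition vec_le :: "real \<Rightarrow> nat \<Rightarrow> 'a vec \<Rightarrow> bool" where
  "vec_le b n x \<longleftrightarrow> x \<in> carrier_vec n \<and> (\<forall>i<n. v (x $ i) \<le> b)"

lemma vec_le_carrier: "vec_le b n x \<Longrightarrow> x \<in> carrier_vec n"
  by (simp add: vec_le_def)

lemma vec_le_mult_mat_vec:
  assumes "entries_le a n A" "vec_le b n x" "0 \<le> a" "0 \<le> b"
  shows "vec_le (a * b) n (A *\<^sub>v x)"
  using assms unfolding entries_le_def vec_le_def
  by (auto simp: scalar_prod_def intro!: v_sum_le v_mult_le)

text \<open>A full \<open>O\<close>-lattice in \<open>F\<^sup>n\<close>. Closure under \<open>O\<close>-linear combinations is asked for \<open>n\<close> vectors at a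
  time, which are the columns of \<open>P\<close>; a bounded submodule containing a ball has rank \<open>n\<close>, so this is
  the form in which a basis is used.\<close>

definition lattice :: "nat \<Rightarrow> 'a vec set \<Rightarrow> bool" where
  "lattice n L \<longleftrightarrow>
     (\<forall>P\<in>carrier_mat n n. \<forall>y. (\<forall>j<n. col P j \<in> L) \<longrightarrow> vec_le 1 n y \<longrightarrow> P *\<^sub>v y \<in> L) \<and>
     (\<exists>C\<ge>0. \<forall>x\<in>L. vec_le C n x) \<and>
     (\<exists>r>0. \<forall>x. vec_le r n x \<longrightarrow> x \<in> L)"

text \<open>The columns of \<open>P\<close> are \<open>n\<close> vectors of \<open>L\<close> spanning a parallelepiped of maximal volume. Such a
  frame will be a basis of \<open>L\<close> over \<open>O\<close>, and \<open>v (det P)\<close> measures the size of \<open>L\<close>.\<close>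

definition max_frame :: "nat \<Rightarrow> 'a vec set \<Rightarrow> 'a mat \<Rightarrow> bool" where
  "max_frame n L P \<longleftrightarrow> P \<in> carrier_mat n n \<and> (\<forall>j<n. col P j \<in> L) \<and> det P \<noteq> 0 \<and>
     (\<forall>Q\<in>carrier_mat n n. (\<forall>j<n. col Q j \<in> L) \<longrightarrow> v (det Q) \<le> v (det P))"

lemma max_frame_exists:
  assumes "lattice n L"
  shows "\<exists>P. max_frame n L P"
proof -
  obtain C where C: "0 \<le> C" "\<And>x. x \<in> L \<Longrightarrow> vec_le C n x"
    using assms unfolding lattice_def by blast
  obtain r where r: "0 < r" "\<And>x. vec_le r n x \<Longrightarrow> x \<in> L"
    using assms unfolding lattice_def by blast
  define X where "X = {P \<in> carrier_mat n n. \<forall>j<n. col P j \<in> L}"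
  have "v (det P) \<le> C ^ n" if "P \<in> X" for P
  proof (rule v_det_le)
    show "entries_le C n P"
      using that C(2) by (force simp: X_def entries_le_def vec_le_def)
  qed fact
  moreover have "\<exists>j. v uniformizer ^ j < r"
    using r(1) uniformizer by (intro real_arch_pow_inv) auto
  then obtain j where j: "v uniformizer ^ j < r" ..
  \<comment> \<open>A small multiple of the standard basis lies in \<open>L\<close>, so the maximal volume is not zero.\<close>
  let ?E = "uniformizer ^ j \<cdot>\<^sub>m 1\<^sub>m n"
  have E: "?E \<in> X"
    unfolding X_def using j r by (auto simp: vec_le_def v_power intro!: r(2))
  ultimately obtain P where P: "P \<in> X" "\<And>Q. Q \<in> X \<Longrightarrow> v (det Q) \<le> v (det P)"
    using v_image_has_max[of X det "C ^ n"] by blast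
  have "det P \<noteq> 0"
  proof
    assume "det P = 0"
    then have "v (det ?E) \<le> 0" using P(2)[OF E] by simp
    moreover have "det ?E \<noteq> 0" by simp
    ultimately show False using v_pos[of "det ?E"] by linarith
  qed
  then show ?thesis using P unfolding max_frame_def X_def by blast
qed

text \<open>By Cramer's rule, replacing the \<open>k\<close>-th vector of the frame by \<open>x\<close> multiplies the determinant by
  the \<open>k\<close>-th coordinate of \<open>x\<close>. By maximality this coordinate is integral.\<close>

lemma max_frame_coordinates:
  assumes "lattice n L" "max_frame n L P" "x \<in> L"
  shows "\<exists>y. vec_le 1 n y \<and> x = P *\<^sub>v y"
proof -
  have P: "P \<in> carrier_mat n n" "\<And>j. j < n \<Longrightarrow> col P j \<in> L" "det P \<noteq> 0"
    "\<And>Q. Q \<in> carrier_mat n n \<Longrightarrow> (\<And>j. j < n \<Longrightarrow> col Q j \<in> L) \<Longrightarrow> v (det Q) \<le> v (det P)"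
    using assms(2) unfolding max_frame_def by auto
  have x: "x \<in> carrier_vec n"
    using assms(1,3) unfolding lattice_def by (auto dest: vec_le_carrier)
  define y where "y = inverse (det P) \<cdot>\<^sub>v (adj_mat P *\<^sub>v x)"
  note adj = adj_mat[OF P(1)]
  have y: "y \<in> carrier_vec n" unfolding y_def using adj(1) x by auto
  have "P *\<^sub>v y = inverse (det P) \<cdot>\<^sub>v ((P * adj_mat P) *\<^sub>v x)"
    unfolding y_def using P(1) adj(1) x
    by (simp add: mult_mat_vec[of _ n n] assoc_mult_mat_vec[of _ n n _ n])
  also have "\<dots> = x"
    unfolding adj(2) using x P(3) by (intro eq_vecI) auto
  finally have Py: "P *\<^sub>v y = x" .
  have "v (y $ k) \<le> 1" if k: "k < n" for k
  proof -
    have "v (det (replace_col P x k)) \<le> v (det P)"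
    proof (rule P(4))
      show "replace_col P x k \<in> carrier_mat n n" using P(1) by (auto simp: replace_col_def)
      fix j assume j: "j < n"
      have "col (replace_col P x k) j = (if j = k then x else col P j)"
        using P(1) x j by (intro eq_vecI) (auto simp: replace_col_def)
      then show "col (replace_col P x k) j \<in> L" using P(2)[OF j] assms(3) by simp
    qed
    moreover have "det (replace_col P x k) = y $ k * det P"
      using cramer_lemma_mat[OF P(1) y k] Py by simp
    ultimately show ?thesis using v_pos[OF P(3)] by (simp add: mult)
  qed
  then show ?thesis using y Py by (auto simp: vec_le_def)
qed

text \<open>A frame of \<open>L'\<close> that is as large as a maximal frame of \<open>L\<close> is itself maximal in \<open>L\<close>, hence a basis
  of both lattices.\<close>

lemma lattice_eqI:
  assumes "lattice n L" "max_frame n L P" "lattice n L'" "max_frame n L' P'"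
    and "L' \<subseteq> L" "v (det P) \<le> v (det P')"
  shows "L' = L"
proof
  show "L \<subseteq> L'"
  proof
    fix x assume x: "x \<in> L"
    have "max_frame n L P'"
      using assms(2,4,5,6) unfolding max_frame_def by (meson order_trans subsetD)
    then obtain y where "vec_le 1 n y" "x = P' *\<^sub>v y"
      using max_frame_coordinates[OF assms(1) _ x] by blast
    then show "x \<in> L'" using assms(3,4) unfolding lattice_def max_frame_def by blast
  qed
qed fact

text \<open>\<open>B\<close> is the matrix of \<open>S\<close> in a basis of the lattice.\<close>

lemma similar_to_integral_if_lattice_stable:
  assumes L: "lattice n L" and S: "S \<in> carrier_mat n n"
    and stable: "\<And>x. x \<in> L \<Longrightarrow> S *\<^sub>v x \<in> L"
  shows "\<exists>B P Q. similar_mat_wit S B P Q \<and> entries_le 1 n B"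
proof -
  obtain P where mf: "max_frame n L P" using max_frame_exists[OF L] by blast
  then have P: "P \<in> carrier_mat n n" "\<And>j. j < n \<Longrightarrow> col P j \<in> L" "det P \<noteq> 0"
    unfolding max_frame_def by auto
  obtain Q where Q: "Q \<in> carrier_mat n n" "P * Q = 1\<^sub>m n" "Q * P = 1\<^sub>m n"
    using det_non_zero_imp_unit[OF P(1,3), of undefined]
    unfolding Units_def by (auto simp: ring_mat_def)
  have "\<exists>y. vec_le 1 n y \<and> S *\<^sub>v col P j = P *\<^sub>v y" if "j < n" for j
    using max_frame_coordinates[OF L mf stable[OF P(2)[OF that]]] .
  then obtain y where y: "\<And>j. j < n \<Longrightarrow> vec_le 1 n (y j)"
      "\<And>j. j < n \<Longrightarrow> S *\<^sub>v col P j = P *\<^sub>v y j"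
    by metis
  define B where "B = mat n n (\<lambda>(i, j). y j $ i)"
  have B: "entries_le 1 n B" using y(1) by (auto simp: entries_le_def B_def vec_le_def)
  note Bc = entries_le_carrier[OF B]
  have colB: "col B j = y j" if "j < n" for j
    using vec_le_carrier[OF y(1)[OF that]] that by (intro eq_vecI) (auto simp: B_def)
  have "S * P = P * B"
  proof (rule eq_matI)
    fix i j assume "i < dim_row (P * B)" "j < dim_col (P * B)"
    then have ij: "i < n" "j < n" using P(1) Bc by auto
    have "(S * P) $$ (i, j) = (S *\<^sub>v col P j) $ i" using ij S P(1) by simp
    also have "\<dots> = (P *\<^sub>v col B j) $ i" using y(2) colB ij by simp
    also have "\<dots> = (P * B) $$ (i, j)" using ij P(1) Bc by simp
    finally show "(S * P) $$ (i, j) = (P * B) $$ (i, j)" .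
  qed (use S P(1) Bc in auto)
  then have "P * B * Q = S * (P * Q)"
    using assoc_mult_mat[OF S P(1) Q(1)] by simp
  also have "\<dots> = S" using Q(2) S by simp
  finally have "P * B * Q = S" .
  then have "similar_mat_wit S B P Q"
    using S P(1) Q Bc unfolding similar_mat_wit_def by (auto simp: Let_def)
  with B show ?thesis by blast
qed

text \<open>
  Let \<open>u\<^bsup>n+1\<^esup> = v \<pi>\<close>. For large \<open>k\<close> the norms of the entries of \<open>T = S\<^sup>k\<close> are at most \<open>u\<^bsup>-k\<^esup>\<close>, so the powers
  \<open>S\<^sup>m\<close> grow at most like \<open>u\<^bsup>-m\<^esup>\<close>. The vectors \<open>x\<close> with \<open>\<parallel>S\<^sup>m x\<parallel> \<le> u\<^bsup>i-m\<^esup>\<close> for all \<open>m\<close> form a decreasing chain of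
  lattices \<open>L\<^sub>i\<close> with \<open>S L\<^bsub>i+1\<^esub> \<subseteq> L\<^sub>i\<close> and \<open>\<pi> L\<^sub>0 \<subseteq> L\<^bsub>n+1\<^esub>\<close>. A proper inclusion shrinks the maximal volume of a
  frame at least by the factor \<open>v \<pi>\<close>, whereas passing from \<open>L\<^sub>0\<close> to \<open>\<pi> L\<^sub>0\<close> costs only the factor \<open>(v \<pi>)\<^sup>n\<close>.
  So one of the \<open>n + 1\<close> inclusions from \<open>L\<^sub>0\<close> down to \<open>L\<^bsub>n+1\<^esub>\<close> is an equality \<open>L\<^bsub>i+1\<^esub> = L\<^sub>i\<close>, and this lattice
  is stable under \<open>S\<close>.
\<close>

lemma root_stabilises_lattice:
  assumes T: "T \<in> carrier_mat n n"
  shows "\<exists>k\<ge>1. \<forall>S\<in>carrier_mat n n. S ^\<^sub>m k = T \<longrightarrow>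
    (\<exists>L. lattice n L \<and> (\<forall>x\<in>L. S *\<^sub>v x \<in> L))"
proof -
  let ?q = "v uniformizer"
  note q = uniformizer(1,2)
  define u where "u = root (n + 1) ?q"
  have u: "0 < u" "u < 1" "u ^ (n + 1) = ?q"
    unfolding u_def using q by (simp_all only: real_root_gt_0_iff real_root_lt_1_iff real_root_pow_pos2 zero_less_Suc Suc_eq_plus1[symmetric] less_imp_le)
  obtain b where b: "1 \<le> b" "entries_le b n T" using entries_le_exists[OF T] by blast
  have "\<exists>c. ?q ^ c < 1 / b"
    using b q by (intro real_arch_pow_inv) auto
  then obtain c where c: "?q ^ c < 1 / b" ..
  \<comment> \<open>Since \<open>u\<^sup>k\<close> is a power of \<open>v \<pi>\<close>, it can be made smaller than the inverse of the norm of \<open>T\<close>.\<close>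
  define k where "k = Suc c * (n + 1)"
  have "u ^ k = ?q ^ Suc c" 
    unfolding k_def u(3)[symmetric] by (simp only: mult.commute[of "Suc c"] power_mult)
  also have "\<dots> \<le> ?q ^ c" using q by (intro power_decreasing) auto
  finally have "b * u ^ k \<le> b * ?q ^ c" using b(1) by (intro mult_left_mono) auto
  also have "\<dots> \<le> 1" using c b(1) by (simp add: field_simps)
  finally have "b \<le> 1 / u ^ k" using u(1) by (simp add: pos_le_divide_eq)
  then have Tb: "entries_le (1 / u ^ k) n T" using b(2) entries_le_mono by blast
  show ?thesis
  proof (intro exI[of _ k] conjI ballI impI)
    show "1 \<le> k" by (simp add: k_def)
    fix S assume S: "S \<in> carrier_mat n n" and Sk: "S ^\<^sub>m k = T"
    define L where "L i = {x \<in> carrier_vec n. \<forall>m. vec_le (u ^ i / u ^ m) n (S ^\<^sub>m m *\<^sub>v x)}" for i :: nat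
    have lat: "lattice n (L i)" for i
      unfolding lattice_def
    proof (intro conjI ballI allI impI)
      fix P y assume P: "P \<in> carrier_mat n n" "\<forall>j<n. col P j \<in> L i" and y: "vec_le 1 n y"
      note yc = vec_le_carrier[OF y]
      show "P *\<^sub>v y \<in> L i"
        unfolding L_def
      proof (intro CollectI conjI allI)
        show "P *\<^sub>v y \<in> carrier_vec n" using mult_mat_vec_carrier[OF P(1) yc] .
        fix m
        have "entries_le (u ^ i / u ^ m) n (S ^\<^sub>m m * P)"
          unfolding entries_le_def
        proof (intro conjI allI impI)
          show "S ^\<^sub>m m * P \<in> carrier_mat n n" using S P(1) by auto
          fix r j assume rj: "r < n" "j < n"
          have "(S ^\<^sub>m m * P) $$ (r, j) = (S ^\<^sub>m m *\<^sub>v col P j) $ r"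
            using rj S P(1) by simp
          then show "v ((S ^\<^sub>m m * P) $$ (r, j)) \<le> u ^ i / u ^ m"
            using P(2) rj unfolding L_def vec_le_def by auto
        qed
        from vec_le_mult_mat_vec[OF this y]
        show "vec_le (u ^ i / u ^ m) n (S ^\<^sub>m m *\<^sub>v (P *\<^sub>v y))"
          using u(1) S P(1) yc by (simp add: assoc_mult_mat_vec[of _ n n _ n])
      qed
    next
      have "vec_le (u ^ i) n x" if "x \<in> L i" for x
      proof -
        from that have "x \<in> carrier_vec n" "vec_le (u ^ i / u ^ 0) n (S ^\<^sub>m 0 *\<^sub>v x)"
          unfolding L_def by blast+
        then show ?thesis using S by simp
      qed
      then show "\<exists>C\<ge>0. \<forall>x\<in>L i. vec_le C n x"
        using u(1) by (intro exI[of _ "u ^ i"]) auto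
    next
      have "\<exists>C\<ge>1. \<forall>r<k'. entries_le C n (S ^\<^sub>m r)" for k'
      proof (induction k')
        case (Suc k')
        then obtain C where C: "1 \<le> C" "\<forall>r<k'. entries_le C n (S ^\<^sub>m r)" by blast
        obtain D where D: "1 \<le> D" "entries_le D n (S ^\<^sub>m k')"
          using entries_le_exists[OF pow_carrier_mat[OF S]] by blast
        show ?case
          using C D by (intro exI[of _ "max C D"]) (auto simp: less_Suc_eq intro: entries_le_mono)
      qed auto
      then obtain C where C: "1 \<le> C" "\<And>r. r < k \<Longrightarrow> entries_le C n (S ^\<^sub>m r)" by blast
      show "\<exists>r>0. \<forall>x. vec_le r n x \<longrightarrow> x \<in> L i"
      proof (intro exI[of _ "u ^ i / C"] conjI allI impI)
        show "0 < u ^ i / C" using u(1) C(1) by simp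
        fix x assume x: "vec_le (u ^ i / C) n x"
        have "vec_le (u ^ i / u ^ m) n (S ^\<^sub>m m *\<^sub>v x)" for m
        proof -
          \<comment> \<open>\<open>S\<^sup>m = T\<^sup>d S\<^sup>r\<close> with \<open>r < k\<close>; the constant \<open>C\<close> takes care of the finitely many \<open>S\<^sup>r\<close>.\<close>
          define d r where "d = m div k" and "r = m mod k"
          have m: "m = k * d + r" unfolding d_def r_def by simp
          have "r < k" unfolding r_def by (simp add: k_def)
          have "S ^\<^sub>m m = T ^\<^sub>m d * S ^\<^sub>m r"
            unfolding m by (simp only: pow_mat_add[OF S] pow_mat_mult[OF S] Sk)
          then have "entries_le ((1 / u ^ k) ^ d * C) n (S ^\<^sub>m m)"
            using entries_le_mult[OF entries_le_pow[OF Tb] C(2)[OF \<open>r < k\<close>], of d] u(1) C(1) by simp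
          then have "vec_le ((1 / u ^ k) ^ d * C * (u ^ i / C)) n (S ^\<^sub>m m *\<^sub>v x)"
            using u(1) C(1) by (intro vec_le_mult_mat_vec x) auto
          moreover have "(1 / u ^ k) ^ d * C * (u ^ i / C) \<le> u ^ i / u ^ m"
          proof -
            have "u ^ m \<le> u ^ (k * d)" using u m by (intro power_decreasing) auto
            then have "u ^ i / u ^ (k * d) \<le> u ^ i / u ^ m"
              using u(1) by (intro divide_left_mono) auto
            then show ?thesis using C(1) u(1) by (simp add: power_mult power_divide)
          qed
          ultimately show ?thesis unfolding vec_le_def by (blast intro: order_trans)
        qed
        then show "x \<in> L i" unfolding L_def using vec_le_carrier[OF x] by simp
      qed
    qed
    have shift: "S *\<^sub>v x \<in> L i" if x: "x \<in> L (Suc i)" for i x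
      unfolding L_def
    proof (intro CollectI conjI allI)
      have xc: "x \<in> carrier_vec n" using x unfolding L_def by simp
      show "S *\<^sub>v x \<in> carrier_vec n" using mult_mat_vec_carrier[OF S xc] .
      fix m
      have "vec_le (u ^ Suc i / u ^ Suc m) n (S ^\<^sub>m Suc m *\<^sub>v x)"
        using x unfolding L_def by blast
      then show "vec_le (u ^ i / u ^ m) n (S ^\<^sub>m m *\<^sub>v (S *\<^sub>v x))"
        using u(1) S xc by (simp add: assoc_mult_mat_vec[of _ n n _ n])
    qed
    have mono: "L (Suc i) \<subseteq> L i" for i
    proof -
      have "u ^ Suc i / u ^ m \<le> u ^ i / u ^ m" for m
        using u by (intro divide_right_mono power_decreasing) auto
      then show ?thesis unfolding L_def vec_le_def by (blast intro: order_trans)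
    qed
    obtain P where P: "\<And>i. max_frame n (L i) (P i)" using max_frame_exists[OF lat] by metis
    define D where "D i = v (det (P i))" for i
    have Dpos: "0 < D i" for i
      using P[of i] v_pos unfolding D_def max_frame_def by blast
    have "\<exists>i\<le>n. L (Suc i) = L i"
    proof (rule ccontr)
      assume "\<not> ?thesis"
      then have ne: "i \<le> n \<Longrightarrow> L (Suc i) \<noteq> L i" for i by blast
      have step: "D (Suc i) \<le> ?q * D i" if "i \<le> n" for i
      proof -
        have "\<not> D i \<le> D (Suc i)"
          using lattice_eqI[OF lat P lat P mono] ne[OF that] unfolding D_def by blast
        then show ?thesis using v_less_imp_le_uniformizer unfolding D_def by simp
      qed
      have "D i \<le> ?q ^ i * D 0" if "i \<le> Suc n" for i
        using that
      proof (induction i)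
        case (Suc i)
        then have "D (Suc i) \<le> ?q * D i" using step by simp
        also have "\<dots> \<le> ?q * (?q ^ i * D 0)" using Suc q by (intro mult_left_mono) auto
        finally show ?case by simp
      qed simp
      then have "D (Suc n) \<le> ?q ^ Suc n * D 0" by blast
      also have "\<dots> < ?q ^ n * D 0" using q Dpos by simp
      finally have less: "D (Suc n) < ?q ^ n * D 0" .
      \<comment> \<open>Multiplying a frame of \<open>L 0\<close> by \<open>\<pi>\<close> gives a frame of \<open>L (Suc n)\<close> that is too large.\<close>
      have P0: "P 0 \<in> carrier_mat n n" "\<And>j. j < n \<Longrightarrow> col (P 0) j \<in> L 0"
        using P[of 0] unfolding max_frame_def by auto
      have "v (det (uniformizer \<cdot>\<^sub>m P 0)) \<le> D (Suc n)"
      proof -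
        have "col (uniformizer \<cdot>\<^sub>m P 0) j \<in> L (Suc n)" if j: "j < n" for j
        proof -
          have eq: "col (uniformizer \<cdot>\<^sub>m P 0) j = uniformizer \<cdot>\<^sub>v col (P 0) j"
            using P0(1) j by (intro eq_vecI) auto
          have "vec_le (u ^ Suc n / u ^ m) n (S ^\<^sub>m m *\<^sub>v (uniformizer \<cdot>\<^sub>v col (P 0) j))" for m
          proof -
            have "vec_le (u ^ 0 / u ^ m) n (S ^\<^sub>m m *\<^sub>v col (P 0) j)"
              using P0(2)[OF j] unfolding L_def by blast
            moreover have "S ^\<^sub>m m *\<^sub>v (uniformizer \<cdot>\<^sub>v col (P 0) j) = uniformizer \<cdot>\<^sub>v (S ^\<^sub>m m *\<^sub>v col (P 0) j)"
              using S P0(1) j by (intro mult_mat_vec[of _ n n]) auto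
            moreover have "u ^ Suc n / u ^ m = ?q * (u ^ 0 / u ^ m)" using u(3) by simp
            moreover have "vec_le (?q * b) n (uniformizer \<cdot>\<^sub>v w)" if "vec_le b n w" for b w
              using that q(1) by (auto simp: vec_le_def mult)
            ultimately show ?thesis by metis
          qed
          then show ?thesis unfolding eq L_def using P0(1) j by auto
        qed
        moreover have "uniformizer \<cdot>\<^sub>m P 0 \<in> carrier_mat n n" using P0(1) by auto
        ultimately show ?thesis using P[of "Suc n"] unfolding D_def max_frame_def by blast
      qed
      moreover have "v (det (uniformizer \<cdot>\<^sub>m P 0)) = ?q ^ n * D 0"
        using P0(1) unfolding D_def by (simp add: mult v_power)
      ultimately show False using less by simp
    qed
    then obtain i where "L (Suc i) = L i" by blast
    with shift lat show "\<exists>L. lattice n L \<and> (\<forall>x\<in>L. S *\<^sub>v x \<in> L)"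
      by (intro exI[of _ "L i"]) auto
  qed
qed

end

section \<open>Nilpotency and divisible groups of matrices\<close>

context nonarch_local_field
begin

text \<open>A weighted Gauss norm: let \<open>W m\<close> consist of the polynomials whose coefficient at \<open>X\<^sup>i\<close> has value
  at most \<open>c\<^bsup>m-i\<^esup>\<close>. These sets are closed under addition, and \<open>W l\<close> times \<open>W m\<close> lies in \<open>W (l + m)\<close>. The
  entries of \<open>X - B\<close> lie in \<open>W 1\<close>, so by the Leibniz formula the determinant lies in \<open>W n\<close>.\<close>

lemma v_coeff_char_poly_le:
  assumes B: "entries_le c n B" and c: "0 < c"
  shows "v (coeff (char_poly B) i) * c ^ i \<le> c ^ n"
proof -
  define W where "W m p \<longleftrightarrow> (\<forall>i. v (coeff p i) * c ^ i \<le> c ^ m)" for m :: nat and p :: "'a poly"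
  have W_mult: "W (l + m) (p * r)" if "W l p" "W m r" for l m p r
    unfolding W_def
  proof
    fix i
    have "v (coeff (p * r) i) \<le> c ^ (l + m) / c ^ i"
      unfolding coeff_mult
    proof (rule v_sum_le)
      fix j assume j: "j \<in> {..i}"
      have "v (coeff p j) * c ^ j * (v (coeff r (i - j)) * c ^ (i - j)) \<le> c ^ l * c ^ m"
        using that c unfolding W_def by (intro mult_mono) (auto simp: nonneg)
      moreover have "c ^ i = c ^ j * c ^ (i - j)" using j by (simp flip: power_add)
      then have "v (coeff p j) * v (coeff r (i - j)) * c ^ i =
          v (coeff p j) * c ^ j * (v (coeff r (i - j)) * c ^ (i - j))" by simp
      ultimately have "v (coeff p j) * v (coeff r (i - j)) * c ^ i \<le> c ^ (l + m)"
        by (simp only: power_add)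
      then show "v (coeff p j * coeff r (i - j)) \<le> c ^ (l + m) / c ^ i"
        using c by (simp add: mult pos_le_divide_eq)
    qed (use c in auto)
    then show "v (coeff (p * r) i) * c ^ i \<le> c ^ (l + m)" using c by (simp add: field_simps)
  qed
  have W_prod: "W (card A) (\<Prod>i\<in>A. f i)" if "finite A" "\<And>i. i \<in> A \<Longrightarrow> W 1 (f i)" for A and f :: "nat \<Rightarrow> 'a poly"
    using that
  proof (induction A rule: finite_induct)
    case empty
    show ?case by (auto simp: W_def coeff_1)
  next
    case (insert x A)
    then show ?case using W_mult[of 1 "f x" "card A" "prod f A"] by simp
  qed
  have W_sum: "W n (sum f A)" if "\<And>i. i \<in> A \<Longrightarrow> W n (f i)" for A and f :: "(nat \<Rightarrow> nat) \<Rightarrow> 'a poly"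
    unfolding W_def coeff_sum
  proof
    fix i
    have "v (\<Sum>x\<in>A. coeff (f x) i) \<le> c ^ n / c ^ i"
      using that c unfolding W_def by (intro v_sum_le) (auto simp: field_simps)
    then show "v (\<Sum>x\<in>A. coeff (f x) i) * c ^ i \<le> c ^ n" using c by (simp add: field_simps)
  qed
  have Bc: "B \<in> carrier_mat n n" using entries_le_carrier[OF B] .
  have entry: "W 1 (char_poly_matrix B $$ (i, j))" if "i < n" "j < n" for i j
    unfolding W_def
  proof
    fix k :: nat
    have *: "char_poly_matrix B $$ (i, j) = [:- (B $$ (i, j)), if i = j then 1 else 0:]"
      using Bc that by (auto simp: char_poly_matrix_def)
    consider "k = 0" | "k = 1" | "k \<ge> 2" by linarith
    then show "v (coeff (char_poly_matrix B $$ (i, j)) k) * c ^ k \<le> c ^ 1"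
    proof cases
      case 3
      then have "coeff (char_poly_matrix B $$ (i, j)) k = 0"
        unfolding * by (auto simp: coeff_pCons split: nat.splits)
      then show ?thesis using c by simp
    qed (use entries_leD[OF B that] c * in auto)
  qed
  have "W n (of_int (sign p) * (\<Prod>i = 0..<n. char_poly_matrix B $$ (i, p i)))"
    if p: "p permutes {0..<n}" for p
  proof -
    have "W (card {0..<n}) (\<Prod>i = 0..<n. char_poly_matrix B $$ (i, p i))"
      using p by (intro W_prod entry) (auto simp: permutes_in_image)
    moreover have "W 0 (of_int (sign p))"
      by (cases "evenperm p") (auto simp: W_def sign_def coeff_1)
    ultimately show ?thesis using W_mult[of 0 _ n] by simp
  qed
  then have "W n (char_poly B)"
    unfolding char_poly_def det_def'[OF char_poly_matrix_closed[OF Bc]] by (intro W_sum) auto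
  then show ?thesis unfolding W_def by blast
qed

end

text \<open>The Cayley-Hamilton argument for the characteristic polynomial \<open>X\<^sup>n\<close>: compare coefficients in
  \<open>(X - E) adj(X - E) = X\<^sup>n\<close>. Writing \<open>B\<^sub>k\<close> for the coefficients of the adjugate this gives
  \<open>B\<^sub>k = E B\<^bsub>k+1\<^esub>\<close> for \<open>k + 1 \<noteq> n\<close>, hence \<open>B\<^sub>k = 0\<close> for \<open>k \<ge> n\<close>. The coefficient at \<open>X\<^sup>n\<close> is then
  \<open>B\<^bsub>n-1\<^esub> = 1\<close>, so \<open>B\<^bsub>n-1-i\<^esub> = E\<^sup>i\<close>, and the constant coefficient gives \<open>0 = E B\<^sub>0 = E\<^sup>n\<close>.\<close>

lemma nilpotent_if_char_poly_monom:
  assumes E: "(E :: 'b :: field mat) \<in> carrier_mat n n" and cp: "char_poly E = monom 1 n"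
  shows "E ^\<^sub>m n = 0\<^sub>m n n"
proof (cases "n = 0")
  case True
  then show ?thesis using E by (intro eq_matI) auto
next
  case n: False
  let ?M = "char_poly_matrix E"
  have M: "?M \<in> carrier_mat n n" using E by simp
  note adj = adj_mat[OF M]
  define B where "B k = mat n n (\<lambda>(i, j). coeff (adj_mat ?M $$ (i, j)) k)" for k
  have Bc [simp]: "B k \<in> carrier_mat n n" for k by (simp add: B_def)
  have entry: "coeff ((?M * adj_mat ?M) $$ (i, j)) k =
      (case k of 0 \<Rightarrow> 0 | Suc k' \<Rightarrow> B k' $$ (i, j)) - (E * B k) $$ (i, j)"
    if ij: "i < n" "j < n" for i j k
  proof -
    let ?a = "\<lambda>l. adj_mat ?M $$ (l, j)"
    have "(?M * adj_mat ?M) $$ (i, j) = (\<Sum>l = 0..<n. ?M $$ (i, l) * ?a l)"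
      using M adj(1) ij by (simp add: scalar_prod_def)
    also have "\<dots> = (\<Sum>l = 0..<n. (if l = i then pCons 0 (?a l) else 0) - Polynomial.smult (E $$ (i, l)) (?a l))"
      using E ij by (intro sum.cong) (auto simp: char_poly_matrix_def)
    also have "\<dots> = pCons 0 (?a i) - (\<Sum>l = 0..<n. Polynomial.smult (E $$ (i, l)) (?a l))"
      using ij by (simp add: sum_subtractf)
    finally show ?thesis
      using E ij by (auto simp: coeff_sum coeff_pCons B_def scalar_prod_def split: nat.splits)
  qed
  have rhs: "coeff ((?M * adj_mat ?M) $$ (i, j)) k = (if i = j \<and> k = n then 1 else 0)"
    if "i < n" "j < n" for i j k
    using that cp unfolding adj(2) char_poly_def by (auto simp: coeff_monom)
  have rec: "B k = E * B (Suc k)" if "Suc k \<noteq> n" for k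
  proof (rule eq_matI)
    fix i j assume "i < dim_row (E * B (Suc k))" "j < dim_col (E * B (Suc k))"
    then have ij: "i < n" "j < n" using E by (auto simp: B_def)
    show "B k $$ (i, j) = (E * B (Suc k)) $$ (i, j)"
      using entry[OF ij, of "Suc k"] rhs[OF ij, of "Suc k"] that by (simp split: if_splits)
  qed (use E in \<open>auto simp: B_def\<close>)
  define d where "d = Max ((\<lambda>(i, j). degree (adj_mat ?M $$ (i, j))) ` ({..<n} \<times> {..<n}))"
  have zero: "B (Suc (d + k)) = 0\<^sub>m n n" for k
  proof (rule eq_matI)
    fix i j assume "i < dim_row (0\<^sub>m n n)" "j < dim_col (0\<^sub>m n n)"
    then have ij: "i < n" "j < n" by auto
    then have "degree (adj_mat ?M $$ (i, j)) \<le> d"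
      unfolding d_def by (intro Max_ge) auto
    then show "B (Suc (d + k)) $$ (i, j) = 0\<^sub>m n n $$ (i, j)"
      using ij by (simp add: B_def coeff_eq_0)
  qed (auto simp: B_def)
  have high: "B k = 0\<^sub>m n n" if "n \<le> k" for k
  proof -
    have "B k' = 0\<^sub>m n n" if "k \<le> k'" "k' \<le> Suc (d + k)" for k'
      using that(2,1)
    proof (induction k' rule: inc_induct)
      case base
      show ?case by (rule zero)
    next
      case (step k')
      then show ?case using rec[of k'] \<open>n \<le> k\<close> E by auto
    qed
    then show ?thesis by simp
  qed
  have top: "B (n - 1) = 1\<^sub>m n"
  proof (rule eq_matI)
    fix i j assume "i < dim_row (1\<^sub>m n)" "j < dim_col (1\<^sub>m n)"
    then have ij: "i < n" "j < n" by auto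
    show "B (n - 1) $$ (i, j) = 1\<^sub>m n $$ (i, j)"
      using entry[OF ij, of n] rhs[OF ij, of n] high[of n] E ij n by (cases n) auto
  qed (auto simp: B_def)
  have pow: "B (n - 1 - i) = E ^\<^sub>m i" if "i < n" for i
    using that
  proof (induction i)
    case 0
    then show ?case using top E by simp
  next
    case (Suc i)
    then have "B (n - 1 - Suc i) = E * B (n - 1 - i)"
      using rec[of "n - 1 - Suc i"] by (simp add: Suc_diff_Suc)
    also have "\<dots> = E ^\<^sub>m Suc i" using Suc pow_mat_add[OF E, of 1 i] E by simp
    finally show ?case .
  qed
  have "E ^\<^sub>m n = E * B 0"
    using pow[of "n - 1"] pow_mat_add[OF E, of 1 "n - 1"] n E by simp
  also have "\<dots> = 0\<^sub>m n n"
  proof (rule eq_matI)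
    fix i j assume "i < dim_row (0\<^sub>m n n)" "j < dim_col (0\<^sub>m n n)"
    then have ij: "i < n" "j < n" by auto
    show "(E * B 0) $$ (i, j) = 0\<^sub>m n n $$ (i, j)"
      using entry[OF ij, of 0] rhs[OF ij, of 0] ij n by simp
  qed (use E in \<open>auto simp: B_def\<close>)
  finally show ?thesis .
qed

context nonarch_local_field
begin

text \<open>Similarity preserves the characteristic polynomial, so by the previous estimate all its
  coefficients below the leading one are arbitrarily small.\<close>

lemma nilpotent_if_similar_to_small:
  assumes E: "E \<in> carrier_mat n n"
    and small: "\<And>j. \<exists>B P Q. similar_mat_wit E B P Q \<and> entries_le (v uniformizer ^ j) n B"
  shows "E ^\<^sub>m n = 0\<^sub>m n n"
proof (rule nilpotent_if_char_poly_monom[OF E])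
  let ?q = "v uniformizer"
  note q = uniformizer(1,2)
  have "coeff (char_poly E) i = 0" if i: "i < n" for i
  proof (rule ccontr)
    assume "coeff (char_poly E) i \<noteq> 0"
    then have pos: "0 < v (coeff (char_poly E) i)" by (rule v_pos)
    then have "\<exists>j. ?q ^ j < v (coeff (char_poly E) i)"
      using q by (intro real_arch_pow_inv) auto
    then obtain j where j: "?q ^ j < v (coeff (char_poly E) i)" ..
    obtain B P Q where B: "similar_mat_wit E B P Q" "entries_le (?q ^ j) n B"
      using small by blast
    then have "char_poly E = char_poly B"
      by (intro char_poly_similar) (auto simp: similar_mat_def)
    then have "v (coeff (char_poly E) i) * (?q ^ j) ^ i \<le> (?q ^ j) ^ n"
      using v_coeff_char_poly_le[OF B(2), of i] q by simp
    also have "\<dots> \<le> (?q ^ j) ^ Suc i"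
      using i q by (intro power_decreasing) (auto simp: power_le_one)
    finally have "v (coeff (char_poly E) i) \<le> ?q ^ j" using q by simp
    with j show False by simp
  qed
  then show "char_poly E = monom 1 n"
    using degree_monic_char_poly[OF E]
    by (intro poly_eqI) (metis coeff_monom coeff_eq_0 linorder_neqE_nat)
qed

text \<open>For each \<open>j\<close>, choose \<open>S\<close> in \<open>H\<close> with \<open>S\<^sup>k = T\<close>, where \<open>k\<close> is the exponent of \<open>GL\<^sub>n(O)\<close> modulo \<open>\<pi>\<^sup>j\<close>. Being a
  high power in \<open>H\<close>, \<open>S\<close> is similar to a matrix over \<open>O\<close>; so is its inverse, which makes the determinant
  a unit.\<close>

theorem divisible_matrix_group_unipotent:
  fixes H :: "'a mat set"
  assumes H: "H \<subseteq> carrier_mat n n"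
    and root: "\<And>T k. T \<in> H \<Longrightarrow> k \<ge> 1 \<Longrightarrow> \<exists>S\<in>H. S ^\<^sub>m k = T"
    and inv: "\<And>T. T \<in> H \<Longrightarrow> \<exists>T'\<in>H. T * T' = 1\<^sub>m n"
    and T: "T \<in> H"
  shows "(T - 1\<^sub>m n) ^\<^sub>m n = 0\<^sub>m n n"
proof (rule nilpotent_if_similar_to_small)
  show "T - 1\<^sub>m n \<in> carrier_mat n n" by auto
  have integral: "\<exists>B P Q. similar_mat_wit S B P Q \<and> entries_le 1 n B" if "S \<in> H" for S
  proof -
    have "S \<in> carrier_mat n n" using that H by blast
    from root_stabilises_lattice[OF this] obtain k where k: "k \<ge> 1"
      "\<And>R. R \<in> carrier_mat n n \<Longrightarrow> R ^\<^sub>m k = S \<Longrightarrow> \<exists>L. lattice n L \<and> (\<forall>x\<in>L. R *\<^sub>v x \<in> L)"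
      by blast
    obtain R where R: "R \<in> H" "R ^\<^sub>m k = S" using root[OF \<open>S \<in> H\<close> k(1)] by blast
    then have Rc: "R \<in> carrier_mat n n" using H by blast
    obtain L where "lattice n L" "\<And>x. x \<in> L \<Longrightarrow> R *\<^sub>v x \<in> L" using k(2)[OF Rc R(2)] by blast
    then obtain B P Q where B: "similar_mat_wit R B P Q" "entries_le 1 n B"
      using similar_to_integral_if_lattice_stable[OF _ Rc] by blast
    show ?thesis
      using similar_mat_wit_pow[OF B(1), of k] entries_le_1_pow[OF B(2), of k] R(2) by blast
  qed
  have det_le: "v (det S) \<le> 1" if "S \<in> H" for S
  proof -
    obtain B P Q where B: "similar_mat_wit S B P Q" "entries_le 1 n B" using integral[OF \<open>S \<in> H\<close>] by blast
    then have "det S = det B" by (intro det_similar) (auto simp: similar_mat_def)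
    then show ?thesis using v_det_le[OF B(2)] by simp
  qed
  have det_1: "v (det S) = 1" if "S \<in> H" for S
  proof -
    obtain S' where S': "S' \<in> H" "S * S' = 1\<^sub>m n" using inv[OF \<open>S \<in> H\<close>] by blast
    have "det S * det S' = 1"
      using det_mult[of S n S'] S' that H by auto
    then have "v (det S) * v (det S') = 1" using mult[of "det S" "det S'"] by simp
    moreover have "v (det S) * v (det S') \<le> v (det S) * 1"
      using det_le[OF S'(1)] by (intro mult_left_mono) (auto simp: nonneg)
    ultimately show ?thesis using det_le[OF that] by simp
  qed
  show "\<exists>B P Q. similar_mat_wit (T - 1\<^sub>m n) B P Q \<and> entries_le (v uniformizer ^ j) n B" for j
  proof -
    obtain k where k: "k \<ge> 1"
      "\<And>A. entries_le 1 n A \<Longrightarrow> v (det A) = 1 \<Longrightarrow> entries_le (v uniformizer ^ j) n (A ^\<^sub>m k - 1\<^sub>m n)"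
      using uniform_power_near_one[of "v uniformizer ^ j" n] uniformizer by auto
    obtain S where S: "S \<in> H" "S ^\<^sub>m k = T" using root[OF T k(1)] by blast
    obtain B P Q where B: "similar_mat_wit S B P Q" "entries_le 1 n B" using integral[OF S(1)] by blast
    have "det S = det B" using B(1) by (intro det_similar) (auto simp: similar_mat_def)
    then have close: "entries_le (v uniformizer ^ j) n (B ^\<^sub>m k - 1\<^sub>m n)"
      using k(2)[OF B(2)] det_1[OF S(1)] by simp
    have Sc: "S \<in> carrier_mat n n" using S(1) H by blast
    have PQ: "P \<in> carrier_mat n n" "Q \<in> carrier_mat n n" "P * Q = 1\<^sub>m n" "Q * P = 1\<^sub>m n"
        "B \<in> carrier_mat n n"
      using B(1) Sc unfolding similar_mat_wit_def Let_def by auto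
    have "T = P * B ^\<^sub>m k * Q" using similar_mat_wit_pow_id[OF B(1), of k] S(2) by simp
    moreover have "P * (B ^\<^sub>m k - 1\<^sub>m n) * Q = P * B ^\<^sub>m k * Q - 1\<^sub>m n"
    proof -
      have "P * (B ^\<^sub>m k - 1\<^sub>m n) = P * B ^\<^sub>m k - P"
        using PQ by (simp add: mult_minus_distrib_mat[of _ n n _ n])
      then show ?thesis using PQ by (simp add: minus_mult_distrib_mat[of _ n n _ _ n])
    qed
    ultimately have "similar_mat_wit (T - 1\<^sub>m n) (B ^\<^sub>m k - 1\<^sub>m n) P Q"
      using PQ unfolding similar_mat_wit_def Let_def by auto
    with close show ?thesis by blast
  qed
qed

end

section \<open>Locally finite representations of divisible groups\<close>

context vector_space
begin

text \<open>A maximal family in \<open>W\<close> that is independent modulo \<open>U\<close>. Its size is bounded because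
  independence modulo \<open>U\<close> implies independence.\<close>

lemma finite_basis_modulo:
  assumes U: "subspace U" and A: "finite A" and W: "W \<subseteq> span A"
  shows "\<exists>(n::nat) b. (\<forall>i<n. b i \<in> W) \<and>
    (\<forall>c. (\<Sum>i<n. c i *s b i) \<in> U \<longrightarrow> (\<forall>i<n. c i = 0)) \<and>
    (\<forall>w\<in>W. \<exists>c. w - (\<Sum>i<n. c i *s b i) \<in> U)"
proof -
  define indep_mod where "indep_mod n b \<longleftrightarrow> (\<forall>i<n. b i \<in> W) \<and>
    (\<forall>c. (\<Sum>i<n. c i *s b i) \<in> U \<longrightarrow> (\<forall>i<n. c i = 0))" for n :: nat and b
  have bound: "n \<le> card A" if b: "indep_mod n b" for n b
  proof -
    have indep: "\<forall>i<n. c i = 0" if "(\<Sum>i<n. c i *s b i) = 0" for c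
      using b that subspace_0[OF U] unfolding indep_mod_def by auto
    have inj: "inj_on b {..<n}"
    proof (rule inj_onI)
      fix i j assume ij: "i \<in> {..<n}" "j \<in> {..<n}" "b i = b j"
      show "i = j"
      proof (rule ccontr)
        assume "i \<noteq> j"
        let ?c = "\<lambda>l. if l = i then 1 else if l = j then - 1 else 0"
        have "(\<Sum>l<n. ?c l *s b l) = (\<Sum>l\<in>{i, j}. ?c l *s b l)"
          using ij by (intro sum.mono_neutral_right) auto
        also have "\<dots> = 0" using \<open>i \<noteq> j\<close> ij(3) by simp
        finally show False using indep[of ?c] ij by (auto split: if_splits)
      qed
    qed
    have "independent (b ` {..<n})"
    proof (rule independent_if_scalars_zero)
      fix c x assume c: "(\<Sum>x\<in>b ` {..<n}. c x *s x) = 0" and "x \<in> b ` {..<n}"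
      have "(\<Sum>i<n. c (b i) *s b i) = 0" using c by (simp add: sum.reindex[OF inj])
      from indep[OF this] show "c x = 0" using \<open>x \<in> b ` {..<n}\<close> by auto
    qed simp
    moreover have "b ` {..<n} \<subseteq> span A" using b W unfolding indep_mod_def by auto
    ultimately have "card (b ` {..<n}) \<le> card A"
      using independent_span_bound[OF A] by blast
    then show ?thesis by (simp add: card_image[OF inj])
  qed
  have "\<exists>n. (\<exists>b. indep_mod n b) \<and> (\<forall>m. (\<exists>b. indep_mod m b) \<longrightarrow> m \<le> n)"
    using bound by (intro ex_has_greatest_nat[of _ 0 _ "Suc (card A)"]) (auto simp: indep_mod_def less_Suc_eq_le)
  then obtain n b where b: "indep_mod n b" and max: "\<And>m b. indep_mod m b \<Longrightarrow> m \<le> n" by blast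
  show ?thesis
  proof (intro exI[of _ n] exI[of _ b] conjI ballI)
    show "\<exists>c. w - (\<Sum>i<n. c i *s b i) \<in> U" if w: "w \<in> W" for w
    proof -
      let ?b = "b(n := w)"
      have "\<not> indep_mod (Suc n) ?b" using max[of "Suc n" ?b] by auto
      then obtain c i where c: "(\<Sum>i<Suc n. c i *s ?b i) \<in> U" "i < Suc n" "c i \<noteq> 0"
        using b w unfolding indep_mod_def by (auto simp: less_Suc_eq)
      have sum: "(\<Sum>i<Suc n. c i *s ?b i) = (\<Sum>i<n. c i *s b i) + c n *s w" by simp
      have cn: "c n \<noteq> 0"
      proof
        assume "c n = 0"
        then have "(\<Sum>i<n. c i *s b i) \<in> U" using c(1) sum by simp
        then show False using b c(2,3) \<open>c n = 0\<close> unfolding indep_mod_def by (auto simp: less_Suc_eq)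
      qed
      have "inverse (c n) *s ((\<Sum>i<n. c i *s b i) + c n *s w) \<in> U"
        using subspace_scale[OF U c(1)] sum by simp
      also have "inverse (c n) *s ((\<Sum>i<n. c i *s b i) + c n *s w) =
          w - (\<Sum>i<n. (- inverse (c n) * c i) *s b i)"
        using cn by (simp add: scale_right_distrib scale_sum_right sum_negf)
      finally show ?thesis by (intro exI)
    qed
  qed (use b in \<open>auto simp: indep_mod_def\<close>)
qed

end

text \<open>A linear representation on the quotient \<open>V / U\<close>, described by maps on representatives in \<open>V\<close>:
  each \<open>\<rho> g\<close> is linear on \<open>V\<close> and preserves \<open>U\<close>, and the laws of an action hold modulo \<open>U\<close>.\<close>

locale representation_modulo = vector_space scale + group \<Gamma>
  for scale :: "'a::field \<Rightarrow> 'b::ab_group_add \<Rightarrow> 'b" and \<Gamma> :: "('g, 'm) monoid_scheme" +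
  fixes U :: "'b set" and \<rho> :: "'g \<Rightarrow> 'b \<Rightarrow> 'b"
  assumes U: "subspace U"
    and rho_add: "g \<in> carrier \<Gamma> \<Longrightarrow> \<rho> g (x + y) = \<rho> g x + \<rho> g y"
    and rho_scale: "g \<in> carrier \<Gamma> \<Longrightarrow> \<rho> g (scale c x) = scale c (\<rho> g x)"
    and rho_U: "g \<in> carrier \<Gamma> \<Longrightarrow> x \<in> U \<Longrightarrow> \<rho> g x \<in> U"
    and rho_mult: "g \<in> carrier \<Gamma> \<Longrightarrow> h \<in> carrier \<Gamma> \<Longrightarrow> \<rho> (g \<otimes>\<^bsub>\<Gamma>\<^esub> h) x - \<rho> g (\<rho> h x) \<in> U"
    and rho_one: "\<rho> \<one>\<^bsub>\<Gamma>\<^esub> x - x \<in> U"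
begin

notation scale (infixr "*s" 75)

definition eqv (infix "\<asymp>" 50) where "x \<asymp> y \<longleftrightarrow> x - y \<in> U"

lemma eqv_refl [simp]: "x \<asymp> x"
  using subspace_0[OF U] by (simp add: eqv_def)

lemma eqv_sym: "x \<asymp> y \<Longrightarrow> y \<asymp> x"
  using subspace_neg[OF U, of "x - y"] by (simp add: eqv_def)

lemma eqv_trans [trans]: "x \<asymp> y \<Longrightarrow> y \<asymp> z \<Longrightarrow> x \<asymp> z"
  using subspace_add[OF U, of "x - y" "y - z"] by (simp add: eqv_def)

lemma eqv_add: "x \<asymp> y \<Longrightarrow> x' \<asymp> y' \<Longrightarrow> x + x' \<asymp> y + y'"
  using subspace_add[OF U, of "x - y" "x' - y'"] by (simp add: eqv_def algebra_simps)

lemma eqv_diff: "x \<asymp> y \<Longrightarrow> x' \<asymp> y' \<Longrightarrow> x - x' \<asymp> y - y'"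
  using subspace_diff[OF U, of "x - y" "x' - y'"] by (simp add: eqv_def algebra_simps)

lemma eqv_scale: "x \<asymp> y \<Longrightarrow> c *s x \<asymp> c *s y"
  using subspace_scale[OF U, of "x - y" c] by (simp add: eqv_def scale_right_diff_distrib)

lemma eqv_sum: "(\<And>i. i \<in> A \<Longrightarrow> f i \<asymp> g i) \<Longrightarrow> sum f A \<asymp> sum g A"
  by (induction A rule: infinite_finite_induct) (auto intro: eqv_add)

lemma rho_diff: "g \<in> carrier \<Gamma> \<Longrightarrow> \<rho> g (x - y) = \<rho> g x - \<rho> g y"
  using rho_add[of g "x - y" y] by simp

lemma rho_eqv: "g \<in> carrier \<Gamma> \<Longrightarrow> x \<asymp> y \<Longrightarrow> \<rho> g x \<asymp> \<rho> g y"
  using rho_U[of g "x - y"] by (simp add: eqv_def rho_diff)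

lemma rho_zero: "g \<in> carrier \<Gamma> \<Longrightarrow> \<rho> g 0 = 0"
  using rho_add[of g 0 0] by simp

lemma rho_sum: "g \<in> carrier \<Gamma> \<Longrightarrow> \<rho> g (sum f A) = (\<Sum>i\<in>A. \<rho> g (f i))"
  by (induction A rule: infinite_finite_induct) (auto simp: rho_zero rho_add)

lemma funpow_diff_eqv:
  "g \<in> carrier \<Gamma> \<Longrightarrow> x \<asymp> y \<Longrightarrow> ((\<lambda>x. \<rho> g x - x) ^^ m) x \<asymp> ((\<lambda>x. \<rho> g x - x) ^^ m) y"
  by (induction m) (auto intro: eqv_diff rho_eqv)

lemma rho_pow:
  assumes g: "g \<in> carrier \<Gamma>"
  shows "\<rho> (g [^]\<^bsub>\<Gamma>\<^esub> (k::nat)) x \<asymp> (\<rho> g ^^ k) x"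
proof (induction k arbitrary: x)
  case 0
  then show ?case using rho_one by (simp add: eqv_def)
next
  case (Suc k)
  have "\<rho> (g [^]\<^bsub>\<Gamma>\<^esub> Suc k) x \<asymp> \<rho> (g [^]\<^bsub>\<Gamma>\<^esub> k) (\<rho> g x)"
    using rho_mult[of "g [^]\<^bsub>\<Gamma>\<^esub> k" g x] g by (simp add: eqv_def)
  also have "\<dots> \<asymp> (\<rho> g ^^ k) (\<rho> g x)" by (rule Suc)
  finally show ?case by (simp add: funpow_swap1)
qed

text \<open>The orbit of \<open>f\<close> spans a finite-dimensional invariant subspace of \<open>V / U\<close>. In a basis \<open>b\<close> of it,
  taken from the orbit itself, the group acts by matrices \<open>a g\<close>. Linear independence modulo \<open>U\<close> makes
  these matrices unique, hence multiplicative in \<open>g\<close>, so they form a divisible group of matrices. The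
  bound \<open>n\<close> is the dimension and serves all \<open>g\<close> at once.\<close>

theorem divisible_imp_unipotent:
  assumes field: "nonarch_local_field (v :: 'a \<Rightarrow> real)"
    and A: "finite A" and orbit: "\<And>g. g \<in> carrier \<Gamma> \<Longrightarrow> \<rho> g f \<in> span A"
    and divisible: "\<And>g k. g \<in> carrier \<Gamma> \<Longrightarrow> k \<ge> 1 \<Longrightarrow> \<exists>h\<in>carrier \<Gamma>. h [^]\<^bsub>\<Gamma>\<^esub> (k::nat) = g"
  shows "\<exists>n. \<forall>g\<in>carrier \<Gamma>. ((\<lambda>x. \<rho> g x - x) ^^ n) f \<in> U"
proof -
  define W where "W = (\<lambda>g. \<rho> g f) ` carrier \<Gamma>"
  have "W \<subseteq> span A" using orbit unfolding W_def by blast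
  from finite_basis_modulo[OF U A this]
  obtain n :: nat and b where b0: "\<forall>i<n. b i \<in> W"
      "\<forall>c. (\<Sum>i<n. c i *s b i) \<in> U \<longrightarrow> (\<forall>i<n. c i = 0)"
      "\<forall>w\<in>W. \<exists>c. w - (\<Sum>i<n. c i *s b i) \<in> U"
    by (elim exE conjE) (rule that)
  note b = b0(1)[rule_format] b0(2)[rule_format] b0(3)[rule_format]
  define comb where "comb c = (\<Sum>i<n. (c $ i) *s b i)" for c :: "'a Matrix.vec"
  have comb_exists: "\<exists>c\<in>carrier_vec n. w \<asymp> comb c" if w: "w \<in> W" for w
  proof -
    obtain c where c: "w - (\<Sum>i<n. c i *s b i) \<in> U" using b(3)[OF w] by blast
    show ?thesis
      by (rule bexI[of _ "vec n c"]) (use c in \<open>auto simp: eqv_def comb_def\<close>)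
  qed
  have comb_eqvD: "c = d" if "comb c \<asymp> comb d" "c \<in> carrier_vec n" "d \<in> carrier_vec n" for c d
  proof -
    have "(\<Sum>i<n. (c $ i - d $ i) *s b i) \<in> U"
      using that(1) by (simp add: eqv_def comb_def scale_left_diff_distrib sum_subtractf)
    then show ?thesis using b(2)[of "\<lambda>i. c $ i - d $ i"] that(2,3) by (intro eq_vecI) auto
  qed
  have comb_unit: "comb (unit_vec n j) = b j" if "j < n" for j
  proof -
    have "comb (unit_vec n j) = (\<Sum>i\<in>{j}. (unit_vec n j $ i) *s b i)"
      unfolding comb_def using that by (intro sum.mono_neutral_right) auto
    then show ?thesis using that by simp
  qed
  have "\<exists>c\<in>carrier_vec n. \<rho> g (b j) \<asymp> comb c" if g: "g \<in> carrier \<Gamma>" and j: "j < n" for g j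
  proof -
    obtain h where h: "h \<in> carrier \<Gamma>" "b j = \<rho> h f" using b(1)[OF j] unfolding W_def by blast
    have "\<rho> (g \<otimes>\<^bsub>\<Gamma>\<^esub> h) f \<asymp> \<rho> g (b j)" using rho_mult[OF g h(1)] h(2) by (simp add: eqv_def)
    moreover have "\<rho> (g \<otimes>\<^bsub>\<Gamma>\<^esub> h) f \<in> W" unfolding W_def using g h by blast
    then obtain c where "c \<in> carrier_vec n" "\<rho> (g \<otimes>\<^bsub>\<Gamma>\<^esub> h) f \<asymp> comb c" using comb_exists by blast
    ultimately show ?thesis using eqv_trans[OF eqv_sym] by blast
  qed
  then have "\<forall>g\<in>carrier \<Gamma>. \<forall>j\<in>{..<n}. \<exists>c. c \<in> carrier_vec n \<and> \<rho> g (b j) \<asymp> comb c" by blast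
  then obtain \<alpha> where "\<forall>g\<in>carrier \<Gamma>. \<forall>j\<in>{..<n}. \<alpha> g j \<in> carrier_vec n \<and> \<rho> g (b j) \<asymp> comb (\<alpha> g j)"
    unfolding bchoice_iff by (elim exE) (rule that)
  then have \<alpha>: "\<And>g j. g \<in> carrier \<Gamma> \<Longrightarrow> j < n \<Longrightarrow> \<alpha> g j \<in> carrier_vec n"
      "\<And>g j. g \<in> carrier \<Gamma> \<Longrightarrow> j < n \<Longrightarrow> \<rho> g (b j) \<asymp> comb (\<alpha> g j)"
    by auto
  define a where "a g = mat n n (\<lambda>(i, j). \<alpha> g j $ i)" for g
  have a [simp]: "a g \<in> carrier_mat n n" for g by (simp add: a_def)
  have rho_comb: "\<rho> g (comb c) \<asymp> comb (a g *\<^sub>v c)" if g: "g \<in> carrier \<Gamma>" and c: "c \<in> carrier_vec n" for g c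
  proof -
    have "\<rho> g (comb c) = (\<Sum>j<n. (c $ j) *s \<rho> g (b j))"
      unfolding comb_def using g by (simp add: rho_sum rho_scale)
    also have "\<dots> \<asymp> (\<Sum>j<n. (c $ j) *s comb (\<alpha> g j))"
      using \<alpha>(2)[OF g] by (intro eqv_sum eqv_scale) auto
    also have "\<dots> = (\<Sum>i<n. \<Sum>j<n. (c $ j) *s (\<alpha> g j $ i) *s b i)"
      unfolding comb_def scale_sum_right by (rule sum.swap)
    also have "\<dots> = comb (a g *\<^sub>v c)"
      unfolding comb_def
    proof (rule sum.cong[OF refl])
      fix i assume i: "i \<in> {..<n}"
      have "(a g *\<^sub>v c) $ i = (\<Sum>j<n. \<alpha> g j $ i * c $ j)"
        using i c by (auto simp: a_def scalar_prod_def lessThan_atLeast0)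
      then show "(\<Sum>j<n. (c $ j) *s (\<alpha> g j $ i) *s b i) = ((a g *\<^sub>v c) $ i) *s b i"
        by (simp add: scale_sum_left mult.commute)
    qed
    finally show ?thesis .
  qed
  have a_eqI: "a g = M" if g: "g \<in> carrier \<Gamma>" and M: "M \<in> carrier_mat n n" "\<And>c. c \<in> carrier_vec n \<Longrightarrow> \<rho> g (comb c) \<asymp> comb (M *\<^sub>v c)" for g M
  proof -
    have eq: "a g *\<^sub>v c = M *\<^sub>v c" if c: "c \<in> carrier_vec n" for c
    proof (rule comb_eqvD)
      show "comb (a g *\<^sub>v c) \<asymp> comb (M *\<^sub>v c)"
        using eqv_trans[OF eqv_sym[OF rho_comb[OF g c]] M(2)[OF c]] .
    qed (rule mult_mat_vec_carrier[OF a c] mult_mat_vec_carrier[OF M(1) c])+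
    show ?thesis
    proof (rule eq_matI)
      fix i j assume "i < dim_row M" "j < dim_col M"
      then have ij: "i < n" "j < n" using M(1) by auto
      have "(a g *\<^sub>v unit_vec n j) $ i = (M *\<^sub>v unit_vec n j) $ i" using eq by simp
      then show "a g $$ (i, j) = M $$ (i, j)" using ij M(1) carrier_matD[OF a] by simp
    qed (use M(1) carrier_matD[OF a] in auto)
  qed
  have a_mult: "a (g \<otimes>\<^bsub>\<Gamma>\<^esub> h) = a g * a h" if gh: "g \<in> carrier \<Gamma>" "h \<in> carrier \<Gamma>" for g h
  proof (rule a_eqI)
    fix c :: "'a Matrix.vec" assume c: "c \<in> carrier_vec n"
    have "\<rho> (g \<otimes>\<^bsub>\<Gamma>\<^esub> h) (comb c) \<asymp> \<rho> g (\<rho> h (comb c))" using rho_mult gh by (simp add: eqv_def)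
    also have "\<dots> \<asymp> \<rho> g (comb (a h *\<^sub>v c))" using gh c by (intro rho_eqv rho_comb)
    also have "\<dots> \<asymp> comb (a g *\<^sub>v (a h *\<^sub>v c))" using gh c mult_mat_vec_carrier[OF a c] by (intro rho_comb)
    also have "a g *\<^sub>v (a h *\<^sub>v c) = a g * a h *\<^sub>v c" using assoc_mult_mat_vec[OF a a c] by simp
    finally show "\<rho> (g \<otimes>\<^bsub>\<Gamma>\<^esub> h) (comb c) \<asymp> comb (a g * a h *\<^sub>v c)" .
  qed (use gh mult_carrier_mat[OF a a] in auto)
  have a_one: "a \<one>\<^bsub>\<Gamma>\<^esub> = 1\<^sub>m n"
    using rho_one by (intro a_eqI) (auto simp: eqv_def)
  have a_pow: "a (g [^]\<^bsub>\<Gamma>\<^esub> k) = a g ^\<^sub>m k" if "g \<in> carrier \<Gamma>" for g and k :: nat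
    using that carrier_matD[OF a] by (induction k) (simp_all add: a_one a_mult)
  interpret F: nonarch_local_field v by (rule field)
  have nilp: "(a g - 1\<^sub>m n) ^\<^sub>m n = 0\<^sub>m n n" if "g \<in> carrier \<Gamma>" for g
  proof (rule F.divisible_matrix_group_unipotent)
    show "a ` carrier \<Gamma> \<subseteq> carrier_mat n n" by auto
    show "\<exists>S\<in>a ` carrier \<Gamma>. S ^\<^sub>m k = T" if "T \<in> a ` carrier \<Gamma>" "1 \<le> k" for T k
    proof -
      obtain g where g: "g \<in> carrier \<Gamma>" "T = a g" using \<open>T \<in> a ` carrier \<Gamma>\<close> by blast
      obtain h where h: "h \<in> carrier \<Gamma>" "h [^]\<^bsub>\<Gamma>\<^esub> k = g" using divisible[OF g(1) \<open>1 \<le> k\<close>] by blast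
      then have "a h ^\<^sub>m k = T" using g(2) a_pow[OF h(1), of k] by simp
      then show ?thesis using h(1) by blast
    qed
    show "\<exists>T'\<in>a ` carrier \<Gamma>. T * T' = 1\<^sub>m n" if "T \<in> a ` carrier \<Gamma>" for T
    proof -
      obtain g where g: "g \<in> carrier \<Gamma>" "T = a g" using \<open>T \<in> a ` carrier \<Gamma>\<close> by blast
      then have "T * a (inv\<^bsub>\<Gamma>\<^esub> g) = 1\<^sub>m n" using a_mult[OF g(1) inv_closed[OF g(1)]] a_one r_inv[OF g(1)] by simp
      then show ?thesis using inv_closed[OF g(1)] by blast
    qed
    show "a g \<in> a ` carrier \<Gamma>" using that by blast
  qed
  show ?thesis
  proof (intro exI ballI)
    fix g assume g: "g \<in> carrier \<Gamma>"
    define N where "N = a g - 1\<^sub>m n"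
    have N: "N \<in> carrier_mat n n" unfolding N_def by (intro minus_carrier_mat) simp
    let ?D = "\<lambda>x. \<rho> g x - x"
    have D: "?D (comb c) \<asymp> comb (N *\<^sub>v c)" if c: "c \<in> carrier_vec n" for c
    proof -
      have "?D (comb c) \<asymp> comb (a g *\<^sub>v c) - comb c" by (intro eqv_diff rho_comb g c eqv_refl)
      also have "\<dots> = comb (N *\<^sub>v c)"
      proof -
        have "N *\<^sub>v c = a g *\<^sub>v c - c"
          unfolding N_def minus_mult_distrib_mat_vec[OF a one_carrier_mat c] using c by simp
        moreover have "(a g *\<^sub>v c - c) $ i = (a g *\<^sub>v c) $ i - c $ i" if "i < n" for i
          using c that by simp
        ultimately show ?thesis
          unfolding comb_def by (simp add: scale_left_diff_distrib sum_subtractf del: index_mult_mat_vec)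
      qed
      finally show ?thesis .
    qed
    have Dm: "(?D ^^ m) (comb c) \<asymp> comb (N ^\<^sub>m m *\<^sub>v c)" if c: "c \<in> carrier_vec n" for m c
    proof (induction m)
      case 0
      then show ?case using c N by simp
    next
      case (Suc m)
      have "(?D ^^ Suc m) (comb c) \<asymp> ?D (comb (N ^\<^sub>m m *\<^sub>v c))"
        using eqv_diff[OF rho_eqv[OF g Suc] Suc] by simp
      also have "\<dots> \<asymp> comb (N *\<^sub>v (N ^\<^sub>m m *\<^sub>v c))"
        by (intro D mult_mat_vec_carrier[OF pow_carrier_mat[OF N] c])
      also have "N *\<^sub>v (N ^\<^sub>m m *\<^sub>v c) = N ^\<^sub>m Suc m *\<^sub>v c"
      proof -
        have "N ^\<^sub>m Suc m = N * N ^\<^sub>m m" using pow_mat_add[OF N, of 1 m] N by simp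
        then show ?thesis using assoc_mult_mat_vec[OF N pow_carrier_mat[OF N] c] by simp
      qed
      finally show ?case .
    qed
    have "\<rho> \<one>\<^bsub>\<Gamma>\<^esub> f \<in> W" unfolding W_def by blast
    from comb_exists[OF this] obtain c
      where c: "c \<in> carrier_vec n" "\<rho> \<one>\<^bsub>\<Gamma>\<^esub> f \<asymp> comb c" ..
    have "f \<asymp> \<rho> \<one>\<^bsub>\<Gamma>\<^esub> f" by (rule eqv_sym) (simp add: eqv_def rho_one)
    from funpow_diff_eqv[OF g eqv_trans[OF this c(2)], of n]
    have f: "(?D ^^ n) f \<asymp> (?D ^^ n) (comb c)" .
    have "N ^\<^sub>m n *\<^sub>v c = 0\<^sub>v n" unfolding N_def nilp[OF g] using c(1) by (intro eq_vecI) auto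
    then have "comb (N ^\<^sub>m n *\<^sub>v c) = 0" unfolding comb_def by simp
    with eqv_trans[OF f Dm[OF c(1)]] have "(?D ^^ n) f \<asymp> 0" by (simp only:)
    then show "(?D ^^ n) f \<in> U" by (simp add: eqv_def)
  qed
qed

end

section \<open>Evaluation of polynomials\<close>

lemma comm_ring_homI:
  assumes "h 1 = 1" "\<And>x y. h (x + y) = h x + h y" "\<And>x y. h (x * y) = h x * h y"
  shows "comm_ring_hom (h :: 'a::comm_ring_1 \<Rightarrow> 'b::comm_ring_1)"
proof -
  have "h 0 = 0" using assms(2)[of 0 0] by simp
  with assms show ?thesis by unfold_locales auto
qed

lemma comm_ring_hom_id: "comm_ring_hom (\<lambda>c. c :: 'a::comm_ring_1)"
  by (rule comm_ring_homI) auto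

lemma comm_ring_hom_Const: "comm_ring_hom (Const :: 'a::comm_ring_1 \<Rightarrow> ('v, 'a) mpoly)"
  by (rule comm_ring_homI) (auto simp: Const_def single_add mult_single)

context
  fixes \<phi> :: "'a::comm_ring_1 \<Rightarrow> 'b::comm_ring_1"
  assumes \<phi>: "comm_ring_hom \<phi>"
begin

interpretation \<phi>: comm_ring_hom \<phi> by (rule \<phi>)

lemma mpoly_eval_superset:
  assumes "finite A" "Poly_Mapping.keys f \<subseteq> A"
  shows "mpoly_eval \<phi> x f = (\<Sum>m\<in>A. \<phi> (Poly_Mapping.lookup f m) *
    (\<Prod>i\<in>Poly_Mapping.keys m. x i ^ Poly_Mapping.lookup m i))"
  unfolding mpoly_eval_def using assms by (intro sum.mono_neutral_left) (auto simp: in_keys_iff)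

lemma mpoly_eval_add: "mpoly_eval \<phi> x (f + g) = mpoly_eval \<phi> x f + mpoly_eval \<phi> x g"
proof -
  let ?A = "Poly_Mapping.keys f \<union> Poly_Mapping.keys g"
  have "finite ?A" "Poly_Mapping.keys (f + g) \<subseteq> ?A" using keys_add[of f g] by auto
  then show ?thesis
    by (simp add: mpoly_eval_superset[of ?A] lookup_add \<phi>.hom_add sum.distrib distrib_right)
qed

lemma mpoly_eval_single:
  "mpoly_eval \<phi> x (Poly_Mapping.single m c) =
    \<phi> c * (\<Prod>i\<in>Poly_Mapping.keys m. x i ^ Poly_Mapping.lookup m i)"
  by (subst mpoly_eval_superset[of "{m}"]) (auto split: if_splits)

lemma mpoly_eval_zero: "mpoly_eval \<phi> x 0 = 0"
  by (simp add: mpoly_eval_def)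

lemma mpoly_eval_sum: "mpoly_eval \<phi> x (sum f A) = (\<Sum>i\<in>A. mpoly_eval \<phi> x (f i))"
  by (induction A rule: infinite_finite_induct) (auto simp: mpoly_eval_zero mpoly_eval_add)

lemma monomial_value_add:
  "(\<Prod>i\<in>Poly_Mapping.keys (m + l). (x i :: 'b) ^ Poly_Mapping.lookup (m + l) i) =
    (\<Prod>i\<in>Poly_Mapping.keys m. x i ^ Poly_Mapping.lookup m i) *
    (\<Prod>i\<in>Poly_Mapping.keys l. x i ^ Poly_Mapping.lookup l i)"
proof -
  let ?A = "Poly_Mapping.keys m \<union> Poly_Mapping.keys l"
  have *: "(\<Prod>i\<in>Poly_Mapping.keys k. x i ^ Poly_Mapping.lookup k i) =
      (\<Prod>i\<in>?A. x i ^ Poly_Mapping.lookup k i)" if "Poly_Mapping.keys k \<subseteq> ?A" for k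
    using that by (intro prod.mono_neutral_left) (auto simp: in_keys_iff)
  show ?thesis
    unfolding *[OF keys_add] *[OF Un_upper1] *[OF Un_upper2]
    by (simp add: lookup_add power_add prod.distrib)
qed

lemma poly_mapping_sum_single:
  "(f :: ('v, 'a) mpoly) = (\<Sum>m\<in>Poly_Mapping.keys f. Poly_Mapping.single m (Poly_Mapping.lookup f m))"
  by (rule poly_mapping_eqI) (auto simp: lookup_sum lookup_single when_def in_keys_iff)

lemma mpoly_eval_mult: "mpoly_eval \<phi> x (f * g) = mpoly_eval \<phi> x f * mpoly_eval \<phi> x g"
proof -
  let ?s = "\<lambda>f m. Poly_Mapping.single m (Poly_Mapping.lookup f m)"
  have "f * g = (\<Sum>m\<in>Poly_Mapping.keys f. \<Sum>l\<in>Poly_Mapping.keys g. ?s f m * ?s g l)"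
    by (subst (1) poly_mapping_sum_single, subst (3) poly_mapping_sum_single) (simp add: sum_product)
  then have "mpoly_eval \<phi> x (f * g) =
      (\<Sum>m\<in>Poly_Mapping.keys f. \<Sum>l\<in>Poly_Mapping.keys g. mpoly_eval \<phi> x (?s f m * ?s g l))"
    by (simp add: mpoly_eval_sum)
  also have "\<dots> = (\<Sum>m\<in>Poly_Mapping.keys f. \<Sum>l\<in>Poly_Mapping.keys g.
      mpoly_eval \<phi> x (?s f m) * mpoly_eval \<phi> x (?s g l))"
    by (simp add: mult_single mpoly_eval_single monomial_value_add \<phi>.hom_mult mult_ac)
  also have "\<dots> = mpoly_eval \<phi> x f * mpoly_eval \<phi> x g"
    by (simp add: sum_product mpoly_eval_single) (simp add: mpoly_eval_def sum_product)
  finally show ?thesis .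
qed

lemma mpoly_eval_Const: "mpoly_eval \<phi> x (Const c) = \<phi> c"
  unfolding Const_def by (simp add: mpoly_eval_single)

lemma mpoly_eval_Var: "mpoly_eval \<phi> x (Var i) = x i"
  unfolding Var_def by (simp add: mpoly_eval_single)

lemma comm_ring_hom_mpoly_eval: "comm_ring_hom (mpoly_eval \<phi> x)"
  using mpoly_eval_Const[of x 1]
  by (intro comm_ring_homI) (auto simp: mpoly_eval_add mpoly_eval_mult Const_def)

end

lemmas eval_at_Const [simp] = mpoly_eval_Const[OF comm_ring_hom_id]
  and eval_at_Var [simp] = mpoly_eval_Var[OF comm_ring_hom_id]
  and subst_poly_Const [simp] = mpoly_eval_Const[OF comm_ring_hom_Const]
  and subst_poly_Var [simp] = mpoly_eval_Var[OF comm_ring_hom_Const]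
  and comm_ring_hom_eval_at = comm_ring_hom_mpoly_eval[OF comm_ring_hom_id]
  and comm_ring_hom_subst_poly = comm_ring_hom_mpoly_eval[OF comm_ring_hom_Const]

text \<open>All composition laws for substitution and evaluation are instances of this one fact.\<close>

lemma hom_mpoly_eval:
  assumes "comm_ring_hom h"
  shows "h (mpoly_eval \<psi> y f) = mpoly_eval (\<lambda>c. h (\<psi> c)) (\<lambda>i. h (y i)) f"
proof -
  interpret comm_ring_hom h by fact
  show ?thesis unfolding mpoly_eval_def by (simp add: hom_sum hom_mult hom_prod hom_power)
qed

lemma subst_subst_poly:
  "subst_poly z (subst_poly y f) = subst_poly (\<lambda>i. subst_poly z (y i)) f"
  by (simp add: hom_mpoly_eval[OF comm_ring_hom_subst_poly])

lemma eval_at_subst_poly: "eval_at x (subst_poly y f) = eval_at (\<lambda>i. eval_at x (y i)) f"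
  by (simp add: hom_mpoly_eval[OF comm_ring_hom_eval_at])

lemma subst_poly_Const_point: "subst_poly (\<lambda>i. Const (x i)) f = Const (eval_at x f)"
  by (simp add: hom_mpoly_eval[OF comm_ring_hom_Const])

lemma subst_poly_id [simp]:
  fixes f :: "('v, 'a::comm_ring_1) mpoly"
  shows "subst_poly Var f = f"
proof -
  have single: "Poly_Mapping.single 0 c * (\<Prod>i\<in>A. Var i ^ e i) =
      Poly_Mapping.single (\<Sum>i\<in>A. Poly_Mapping.single i (e i)) (c :: 'a)" for c :: 'a and A and e :: "'v \<Rightarrow> nat"
  proof (induction A rule: infinite_finite_induct)
    case (insert i A)
    have pow: "(Var i :: ('v, 'a) mpoly) ^ k = Poly_Mapping.single (Poly_Mapping.single i k) 1" for k
      by (induction k) (auto simp: Var_def mult_single simp flip: single_add)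
    have "Poly_Mapping.single 0 c * (\<Prod>i\<in>insert i A. Var i ^ e i) =
        Poly_Mapping.single (Poly_Mapping.single i (e i)) 1 * (Poly_Mapping.single 0 c * (\<Prod>i\<in>A. Var i ^ e i))"
      unfolding prod.insert[OF insert(1,2)] pow by (rule mult.left_commute)
    then show ?case using insert by (simp add: mult_single)
  qed auto
  have sum: "(\<Sum>i\<in>Poly_Mapping.keys m. Poly_Mapping.single i (Poly_Mapping.lookup m i)) = m" for m :: "'v \<Rightarrow>\<^sub>0 nat"
    by (rule poly_mapping_eqI) (auto simp: lookup_sum lookup_single when_def in_keys_iff)
  have "Const c * (\<Prod>i\<in>Poly_Mapping.keys m. Var i ^ Poly_Mapping.lookup m i) = Poly_Mapping.single m c"
    for c :: 'a and m :: "'v \<Rightarrow>\<^sub>0 nat"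
    unfolding Const_def single sum ..
  then show ?thesis
    unfolding mpoly_eval_def using poly_mapping_sum_single[OF comm_ring_hom_id, of f] by simp
qed

section \<open>Ideals\<close>

lemma module_mult: "Modules.module ((*) :: 'r::comm_ring_1 \<Rightarrow> 'r \<Rightarrow> 'r)"
  by unfold_locales (auto simp: algebra_simps)

lemma ring_ideal_iff:
  "ring_ideal I \<longleftrightarrow> 0 \<in> I \<and> (\<forall>x\<in>I. \<forall>y\<in>I. x + y \<in> I) \<and> (\<forall>c. \<forall>x\<in>I. c * x \<in> I)"
  by (simp add: module.subspace_def[OF module_mult])

lemma ring_ideal_mult: "ring_ideal I \<Longrightarrow> x \<in> I \<Longrightarrow> c * x \<in> I"
  by (rule module.subspace_scale[OF module_mult])

lemma ring_ideal_diff: "ring_ideal I \<Longrightarrow> x \<in> I \<Longrightarrow> y \<in> I \<Longrightarrow> x - y \<in> I"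
  by (rule module.subspace_diff[OF module_mult])

lemma ring_ideal_sum: "ring_ideal I \<Longrightarrow> (\<And>i. i \<in> A \<Longrightarrow> f i \<in> I) \<Longrightarrow> sum f A \<in> I"
  by (rule module.subspace_sum[OF module_mult])

lemma hom_ideal_gen:
  assumes h: "comm_ring_hom h" and J: "ring_ideal J" and S: "\<And>s. s \<in> S \<Longrightarrow> h s \<in> J"
    and f: "f \<in> ideal_gen S"
  shows "h f \<in> J"
proof -
  interpret h: comm_ring_hom h by (rule h)
  show ?thesis
    using f J S unfolding ring_ideal_iff
    by (induction rule: module.span_induct[OF module_mult, consumes 1])
      (auto simp: module.subspace_def[OF module_mult] h.hom_add h.hom_mult)
qed

lemma ideal_prod_cong:
  assumes J: "ring_ideal J" and "\<And>i. i \<in> A \<Longrightarrow> x i - y i \<in> J"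
  shows "prod x A - prod y A \<in> J"
  using assms(2)
proof (induction A rule: infinite_finite_induct)
  case (insert i A)
  have "prod x (insert i A) - prod y (insert i A) = x i * (prod x A - prod y A) + prod y A * (x i - y i)"
    using insert(1,2) by (simp add: algebra_simps)
  then show ?case using insert J unfolding ring_ideal_iff by auto
qed (use J in \<open>auto simp: ring_ideal_iff\<close>)

lemma subst_poly_cong_mod:
  assumes J: "ring_ideal J" and xy: "\<And>i. x i - y i \<in> J"
  shows "subst_poly x f - subst_poly y f \<in> J"
proof -
  have pow: "x i ^ k - y i ^ k \<in> J" for i k
    using ideal_prod_cong[OF J, of "{..<k}" "\<lambda>_. x i" "\<lambda>_. y i"] xy by simp
  have "subst_poly x f - subst_poly y f = (\<Sum>m\<in>Poly_Mapping.keys f. Const (Poly_Mapping.lookup f m) *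
      ((\<Prod>i\<in>Poly_Mapping.keys m. x i ^ Poly_Mapping.lookup m i) -
       (\<Prod>i\<in>Poly_Mapping.keys m. y i ^ Poly_Mapping.lookup m i)))"
    unfolding mpoly_eval_def by (simp add: sum_subtractf right_diff_distrib)
  also have "\<dots> \<in> J"
    by (rule ring_ideal_sum[OF J], rule ring_ideal_mult[OF J], rule ideal_prod_cong[OF J], rule pow)
  finally show ?thesis .
qed

section \<open>The group of rational points\<close>

lemma subst_poly_poly_mult:
  "subst_poly Z (poly_mult G X Y i) = poly_mult G (\<lambda>i. subst_poly Z (X i)) (\<lambda>i. subst_poly Z (Y i)) i"
proof -
  have "(\<lambda>s. subst_poly Z (case_sum X Y s)) = case_sum (\<lambda>i. subst_poly Z (X i)) (\<lambda>i. subst_poly Z (Y i))"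
    by (auto split: sum.splits)
  then show ?thesis unfolding poly_mult_def subst_subst_poly by simp
qed

lemma poly_mult_Const:
  "(poly_mult G (\<lambda>i. Const (g i)) (\<lambda>i. Const (h i)) i :: ('w, 'a::field) mpoly) =
    Const (eval_at (case_sum g h) (mu G i))"
proof -
  have "(case_sum (\<lambda>i. Const (g i)) (\<lambda>i. Const (h i)) :: _ \<Rightarrow> ('w, 'a) mpoly) = (\<lambda>s. Const (case_sum g h s))"
    by (auto split: sum.splits)
  then show ?thesis unfolding poly_mult_def by (simp add: subst_poly_Const_point)
qed

lemma Const_0 [simp]: "Const 0 = 0"
  by (simp add: Const_def)

lemma Const_eq_0_iff [simp]: "Const c = 0 \<longleftrightarrow> c = 0"
  by (metis Const_def lookup_single_eq lookup_zero single_zero)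

lemma Const_eq_iff [simp]: "Const c = Const d \<longleftrightarrow> c = d"
  by (metis Const_def lookup_single_eq)

context affine_group_scheme
begin

text \<open>The functor of points: \<open>X\<close> is a point of \<open>G\<close> with values in the quotient of a polynomial ring by
  \<open>J\<close>. The generic point (modulo the ideal of \<open>G\<close>) and the rational points (modulo zero) are both of this
  kind, so the group laws below serve for \<open>G(F)\<close> and for right translation alike.\<close>

definition point_mod :: "('w, 'a) mpoly set \<Rightarrow> ('v \<Rightarrow> ('w, 'a) mpoly) \<Rightarrow> bool" where
  "point_mod J X \<longleftrightarrow> ring_ideal J \<and> (\<forall>f\<in>ideal_of G. subst_poly X f \<in> J)"

lemma point_mod_ideal: "point_mod J X \<Longrightarrow> ring_ideal J"
  by (simp add: point_mod_def)

lemma point_mod_Var: "point_mod (ideal_of G) Var"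
  using ideal by (simp add: point_mod_def)

lemma subst_ideal2:
  assumes X: "point_mod J X" and Y: "point_mod J Y" and f: "f \<in> ideal2 G"
  shows "subst_poly (case_sum X Y) f \<in> J"
  using f unfolding ideal2_def
  by (rule hom_ideal_gen[OF comm_ring_hom_subst_poly point_mod_ideal[OF X], rotated])
    (use X Y in \<open>auto simp: subst_subst_poly point_mod_def\<close>)

lemma subst_ideal3:
  assumes X: "point_mod J X" and Y: "point_mod J Y" and Z: "point_mod J Z" and f: "f \<in> ideal3 G"
  shows "subst_poly (case_sum X (case_sum Y Z)) f \<in> J"
  using f unfolding ideal3_def
  by (rule hom_ideal_gen[OF comm_ring_hom_subst_poly point_mod_ideal[OF X], rotated])
    (use X Y Z in \<open>auto simp: subst_subst_poly point_mod_def\<close>)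

lemma point_mod_poly_mult:
  assumes X: "point_mod J X" and Y: "point_mod J Y"
  shows "point_mod J (poly_mult G X Y)"
  unfolding point_mod_def
proof (intro conjI ballI)
  fix f assume "f \<in> ideal_of G"
  then have "subst_poly (case_sum X Y) (subst_poly (mu G) f) \<in> J"
    by (intro subst_ideal2[OF X Y] mu_welldef)
  then show "subst_poly (poly_mult G X Y) f \<in> J" by (simp add: subst_subst_poly poly_mult_def)
qed (rule point_mod_ideal[OF X])

lemma poly_mult_assoc_mod:
  assumes X: "point_mod J X" and Y: "point_mod J Y" and Z: "point_mod J Z"
  shows "poly_mult G (poly_mult G X Y) Z i - poly_mult G X (poly_mult G Y Z) i \<in> J"
proof -
  interpret h: comm_ring_hom "subst_poly (case_sum X (case_sum Y Z))"
    by (rule comm_ring_hom_subst_poly)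
  from subst_ideal3[OF X Y Z assoc[of i]] show ?thesis
    by (simp add: h.hom_minus subst_poly_poly_mult o_def)
qed

lemma poly_mult_unit_mod:
  assumes X: "point_mod J X"
  shows "poly_mult G (\<lambda>i. Const (unt G i)) X i - X i \<in> J"
    and "poly_mult G X (\<lambda>i. Const (unt G i)) i - X i \<in> J"
proof -
  interpret h: comm_ring_hom "subst_poly X" by (rule comm_ring_hom_subst_poly)
  have "subst_poly X (poly_mult G (Const \<circ> unt G) Var i - Var i) \<in> J"
    "subst_poly X (poly_mult G Var (Const \<circ> unt G) i - Var i) \<in> J"
    using X left_unit right_unit unfolding point_mod_def by blast+
  then show "poly_mult G (\<lambda>i. Const (unt G i)) X i - X i \<in> J"
    and "poly_mult G X (\<lambda>i. Const (unt G i)) i - X i \<in> J"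
    by (simp_all add: h.hom_minus subst_poly_poly_mult o_def)
qed

lemma poly_mult_inverse_mod:
  assumes X: "point_mod J X"
  shows "poly_mult G (\<lambda>i. subst_poly X (iota G i)) X i - Const (unt G i) \<in> J"
proof -
  interpret h: comm_ring_hom "subst_poly X" by (rule comm_ring_hom_subst_poly)
  have "subst_poly X (poly_mult G (iota G) Var i - Const (unt G i)) \<in> J"
    using X left_inverse unfolding point_mod_def by blast
  then show ?thesis by (simp add: h.hom_minus subst_poly_poly_mult o_def)
qed

lemma rational_point_iff: "g \<in> carrier (rational_points G) \<longleftrightarrow> (\<forall>f\<in>ideal_of G. eval_at g f = 0)"
  by (simp add: rational_points_def)

lemma point_mod_Const:
  assumes "g \<in> carrier (rational_points G)" "ring_ideal J"
  shows "point_mod J (\<lambda>i. Const (g i))"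
  using assms unfolding point_mod_def rational_point_iff
  by (auto simp: subst_poly_Const_point ring_ideal_iff)

lemma ring_ideal_zero: "ring_ideal {0 :: ('v, 'a) mpoly}"
  by (simp add: ring_ideal_iff)

lemma rational_point_iff_point_mod:
  "g \<in> carrier (rational_points G) \<longleftrightarrow> point_mod {0 :: ('v, 'a) mpoly} (\<lambda>i. Const (g i))"
  using ring_ideal_zero by (simp add: point_mod_def rational_point_iff subst_poly_Const_point)

lemma Const_rational_mult:
  "(\<lambda>i. Const ((g \<otimes>\<^bsub>rational_points G\<^esub> h) i)) =
    poly_mult G (\<lambda>i. Const (g i)) (\<lambda>i. Const (h i))"
  by (rule ext) (simp add: poly_mult_Const rational_points_def)

lemma group_rational_points: "group (rational_points G)"
proof (rule groupI)
  let ?\<Gamma> = "rational_points G"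
  let ?C = "\<lambda>g i. Const (g i) :: ('v, 'a) mpoly"
  note pm = rational_point_iff_point_mod
  have eqI: "g = h" if "\<And>i. ?C g i - ?C h i \<in> {0}" for g h :: "'v \<Rightarrow> 'a"
    using that by (intro ext) simp
  show "g \<otimes>\<^bsub>?\<Gamma>\<^esub> h \<in> carrier ?\<Gamma>" if "g \<in> carrier ?\<Gamma>" "h \<in> carrier ?\<Gamma>" for g h
    unfolding pm Const_rational_mult using that[unfolded pm] by (rule point_mod_poly_mult)
  have one_eq: "\<one>\<^bsub>?\<Gamma>\<^esub> = unt G" by (simp add: rational_points_def)
  show "\<one>\<^bsub>?\<Gamma>\<^esub> \<in> carrier ?\<Gamma>"
    using unit_welldef by (simp add: rational_points_def)
  show "g \<otimes>\<^bsub>?\<Gamma>\<^esub> h \<otimes>\<^bsub>?\<Gamma>\<^esub> k = g \<otimes>\<^bsub>?\<Gamma>\<^esub> (h \<otimes>\<^bsub>?\<Gamma>\<^esub> k)"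
    if "g \<in> carrier ?\<Gamma>" "h \<in> carrier ?\<Gamma>" "k \<in> carrier ?\<Gamma>" for g h k
  proof (rule eqI)
    fix i
    show "?C (g \<otimes>\<^bsub>?\<Gamma>\<^esub> h \<otimes>\<^bsub>?\<Gamma>\<^esub> k) i - ?C (g \<otimes>\<^bsub>?\<Gamma>\<^esub> (h \<otimes>\<^bsub>?\<Gamma>\<^esub> k)) i \<in> {0}"
      unfolding Const_rational_mult[THEN fun_cong] Const_rational_mult
      by (rule poly_mult_assoc_mod[OF that[unfolded pm]])
  qed
  show "\<one>\<^bsub>?\<Gamma>\<^esub> \<otimes>\<^bsub>?\<Gamma>\<^esub> g = g" if "g \<in> carrier ?\<Gamma>" for g
  proof (rule eqI)
    fix i
    show "?C (\<one>\<^bsub>?\<Gamma>\<^esub> \<otimes>\<^bsub>?\<Gamma>\<^esub> g) i - ?C g i \<in> {0}"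
      unfolding Const_rational_mult[THEN fun_cong] one_eq
      by (rule poly_mult_unit_mod(1)[OF that[unfolded pm]])
  qed
  show "\<exists>h\<in>carrier ?\<Gamma>. h \<otimes>\<^bsub>?\<Gamma>\<^esub> g = \<one>\<^bsub>?\<Gamma>\<^esub>" if g: "g \<in> carrier ?\<Gamma>" for g
  proof (intro bexI)
    let ?h = "\<lambda>i. eval_at g (iota G i)"
    show "?h \<in> carrier ?\<Gamma>"
      unfolding rational_point_iff
    proof
      fix f assume "f \<in> ideal_of G"
      then have "eval_at g (subst_poly (iota G) f) = 0"
        using iota_welldef g unfolding rational_point_iff by blast
      then show "eval_at ?h f = 0" by (simp add: eval_at_subst_poly)
    qed
    show "?h \<otimes>\<^bsub>?\<Gamma>\<^esub> g = \<one>\<^bsub>?\<Gamma>\<^esub>"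
    proof (rule eqI)
      fix i
      show "?C (?h \<otimes>\<^bsub>?\<Gamma>\<^esub> g) i - ?C \<one>\<^bsub>?\<Gamma>\<^esub> i \<in> {0}"
        unfolding Const_rational_mult[THEN fun_cong] one_eq
        using poly_mult_inverse_mod[OF g[unfolded pm], of i]
        unfolding subst_poly_Const_point .
    qed
  qed
qed

section \<open>Right translation\<close>

lemma right_translation_eq:
  "right_translation G g f = subst_poly (poly_mult G Var (\<lambda>i. Const (g i))) f"
  by (simp add: right_translation_def o_def)

lemma comm_ring_hom_right_translation: "comm_ring_hom (right_translation G g)"
  unfolding right_translation_eq[abs_def] by (rule comm_ring_hom_subst_poly)

lemma right_translation_ideal:
  assumes "g \<in> carrier (rational_points G)" "f \<in> ideal_of G"
  shows "right_translation G g f \<in> ideal_of G"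
  using point_mod_poly_mult[OF point_mod_Var point_mod_Const[OF assms(1) ideal]] assms(2)
  unfolding right_translation_eq point_mod_def by blast

text \<open>Both sides are substitutions, of \<open>x (g h)\<close> and of \<open>(x g) h\<close> for the generic point \<open>x\<close>, and these
  points agree modulo the ideal of \<open>G\<close> by associativity.\<close>

lemma right_translation_mult:
  assumes "g \<in> carrier (rational_points G)" "h \<in> carrier (rational_points G)"
  shows "right_translation G (g \<otimes>\<^bsub>rational_points G\<^esub> h) f -
    right_translation G g (right_translation G h f) \<in> ideal_of G"
proof -
  let ?g = "\<lambda>i. Const (g i)" and ?h = "\<lambda>i. Const (h i)"
  have "right_translation G g (right_translation G h f) =
      subst_poly (poly_mult G (poly_mult G Var ?g) ?h) f"
    unfolding right_translation_eq subst_subst_poly by (simp add: subst_poly_poly_mult)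
  moreover have "right_translation G (g \<otimes>\<^bsub>rational_points G\<^esub> h) f =
      subst_poly (poly_mult G Var (poly_mult G ?g ?h)) f"
    unfolding right_translation_eq Const_rational_mult ..
  moreover have "poly_mult G Var (poly_mult G ?g ?h) i - poly_mult G (poly_mult G Var ?g) ?h i \<in> ideal_of G" for i
  proof -
    have "- 1 * (poly_mult G (poly_mult G Var ?g) ?h i - poly_mult G Var (poly_mult G ?g ?h) i) \<in> ideal_of G"
      using assms ideal
      by (intro ring_ideal_mult poly_mult_assoc_mod point_mod_Var point_mod_Const)
    then show ?thesis by simp
  qed
  ultimately show ?thesis by (simp add: subst_poly_cong_mod[OF ideal])
qed

lemma right_translation_one: "right_translation G \<one>\<^bsub>rational_points G\<^esub> f - f \<in> ideal_of G"
proof -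
  have "poly_mult G Var (\<lambda>i. Const (unt G i)) i - Var i \<in> ideal_of G" for i
    by (rule poly_mult_unit_mod(2)[OF point_mod_Var])
  then have "subst_poly (poly_mult G Var (\<lambda>i. Const (unt G i))) f - subst_poly Var f \<in> ideal_of G"
    by (intro subst_poly_cong_mod[OF ideal])
  then show ?thesis
    by (simp add: right_translation_eq rational_points_def)
qed

text \<open>Local finiteness: the comultiplication expands \<open>f (x g)\<close> as a finite sum of products of a monomial
  in \<open>x\<close> and a scalar depending on \<open>g\<close>. The monomials, here obtained by setting the coordinates of \<open>g\<close> to
  one, do not depend on \<open>g\<close>.\<close>

lemma right_translation_finite_span:
  "\<exists>A. finite A \<and> (\<forall>g. right_translation G g f \<in> module.span (\<lambda>c h. Const c * h) A)"
proof -
  let ?span = "module.span (\<lambda>c (h :: ('v, 'a) mpoly). Const c * h)"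
  interpret C: comm_ring_hom "Const :: 'a \<Rightarrow> ('v, 'a) mpoly" by (rule comm_ring_hom_Const)
  interpret vector_space "\<lambda>c (h :: ('v, 'a) mpoly). Const c * h"
    by unfold_locales (auto simp: algebra_simps C.hom_add C.hom_mult)
  define F where "F = subst_poly (mu G) f"
  define M :: "('v + 'v \<Rightarrow>\<^sub>0 nat) \<Rightarrow> ('v, 'a) mpoly" where
    "M m = (\<Prod>i\<in>Poly_Mapping.keys m. case_sum Var (\<lambda>_. 1) i ^ Poly_Mapping.lookup m i)"
    for m :: "'v + 'v \<Rightarrow>\<^sub>0 nat"
  show ?thesis
  proof (intro exI[of _ "M ` Poly_Mapping.keys F"] conjI allI)
    fix g
    have "right_translation G g f = subst_poly (case_sum Var (\<lambda>i. Const (g i))) F"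
      unfolding right_translation_eq F_def subst_subst_poly poly_mult_def ..
    also have "\<dots> = (\<Sum>m\<in>Poly_Mapping.keys F. Const (Poly_Mapping.lookup F m *
        (\<Prod>i\<in>Poly_Mapping.keys m. case_sum (\<lambda>_. 1) g i ^ Poly_Mapping.lookup m i)) * M m)"
      unfolding mpoly_eval_def
    proof (rule sum.cong[OF refl])
      fix m
      have "(case_sum Var (\<lambda>i. Const (g i)) i :: ('v, 'a) mpoly) = Const (case_sum (\<lambda>_. 1) g i) * case_sum Var (\<lambda>_. 1) i"
        for i by (auto split: sum.splits)
      then show "Const (Poly_Mapping.lookup F m) * (\<Prod>i\<in>Poly_Mapping.keys m.
            case_sum Var (\<lambda>i. Const (g i)) i ^ Poly_Mapping.lookup m i) =
          Const (Poly_Mapping.lookup F m *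
            (\<Prod>i\<in>Poly_Mapping.keys m. case_sum (\<lambda>_. 1) g i ^ Poly_Mapping.lookup m i)) * M m"
        by (simp add: M_def power_mult_distrib prod.distrib C.hom_mult C.hom_prod C.hom_power)
    qed
    also have "\<dots> \<in> ?span (M ` Poly_Mapping.keys F)"
      by (intro span_sum span_scale span_base) auto
    finally show "right_translation G g f \<in> ?span (M ` Poly_Mapping.keys F)" .
  qed simp
qed

lemma representation_right_translation:
  "representation_modulo (\<lambda>c h. Const c * h) (rational_points G) (ideal_of G) (right_translation G)"
proof -
  interpret C: comm_ring_hom "Const :: 'a \<Rightarrow> ('v, 'a) mpoly" by (rule comm_ring_hom_Const)
  interpret V: vector_space "\<lambda>c (h :: ('v, 'a) mpoly). Const c * h"
    by unfold_locales (auto simp: algebra_simps C.hom_add C.hom_mult)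
  interpret group "rational_points G" by (rule group_rational_points)
  show ?thesis
  proof unfold_locales
    show "V.subspace (ideal_of G)" using ideal unfolding ring_ideal_iff V.subspace_def by blast
    fix g x y c assume "g \<in> carrier (rational_points G)"
    interpret R: comm_ring_hom "right_translation G g" by (rule comm_ring_hom_right_translation)
    show "right_translation G g (x + y) = right_translation G g x + right_translation G g y"
      by (rule R.hom_add)
    have "right_translation G g (Const c) = Const c" unfolding right_translation_eq by (rule subst_poly_Const)
    then show "right_translation G g (Const c * x) = Const c * right_translation G g x"
      unfolding R.hom_mult by simp
  next
    fix g x assume "g \<in> carrier (rational_points G)" "x \<in> ideal_of G"
    then show "right_translation G g x \<in> ideal_of G" by (rule right_translation_ideal)
  next
    fix g h x assume "g \<in> carrier (rational_points G)" "h \<in> carrier (rational_points G)"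
    then show "right_translation G (g \<otimes>\<^bsub>rational_points G\<^esub> h) x -
      right_translation G g (right_translation G h x) \<in> ideal_of G"
      by (rule right_translation_mult)
  next
    fix x show "right_translation G \<one>\<^bsub>rational_points G\<^esub> x - x \<in> ideal_of G"
      by (rule right_translation_one)
  qed
qed

text \<open>The action on \<open>F[G]\<close> is faithful: evaluating the translated coordinate functions at the identity
  recovers the coordinates of \<open>g\<close>.\<close>

lemma rational_point_eq_oneI:
  assumes g: "g \<in> carrier (rational_points G)"
    and "\<And>i. right_translation G g (Var i) - Var i \<in> ideal_of G"
  shows "g = \<one>\<^bsub>rational_points G\<^esub>"
proof -
  interpret group "rational_points G" by (rule group_rational_points)
  interpret ev: comm_ring_hom "eval_at (unt G)" by (rule comm_ring_hom_eval_at)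
  have split: "(\<lambda>s. eval_at (unt G) (case_sum Var (\<lambda>i. Const (g i)) s)) = case_sum (unt G) g"
    by (auto split: sum.splits)
  have "eval_at (case_sum (unt G) g) (mu G i) = unt G i" for i
  proof -
    have "eval_at (unt G) (right_translation G g (Var i) - Var i) = 0"
      by (rule unit_welldef[OF assms(2)])
    then have "eval_at (unt G) (right_translation G g (Var i)) = unt G i"
      unfolding ev.hom_minus eval_at_Var by simp
    then show ?thesis
      unfolding right_translation_eq subst_poly_Var poly_mult_def eval_at_subst_poly split .
  qed
  then have "\<one>\<^bsub>rational_points G\<^esub> \<otimes>\<^bsub>rational_points G\<^esub> g = \<one>\<^bsub>rational_points G\<^esub>"
    unfolding rational_points_def by simp
  then show ?thesis unfolding l_one[OF g] .
qed

end

section \<open>Groups of rational points with surjective power maps\<close>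

context affine_group_scheme
begin

theorem divisible_uniformly_unipotent:
  assumes "nonarch_local_field (v :: 'a \<Rightarrow> real)"
    and "\<And>k::nat. k \<ge> 1 \<Longrightarrow>
      power_map G k ` carrier (rational_points G) = carrier (rational_points G)"
  shows "\<exists>n. \<forall>g\<in>carrier (rational_points G).
    ((\<lambda>h. right_translation G g h - h) ^^ n) f \<in> ideal_of G"
proof -
  interpret representation_modulo "\<lambda>c h. Const c * h" "rational_points G" "ideal_of G" "right_translation G"
    by (rule representation_right_translation)
  obtain A where A: "finite A" "\<And>g. right_translation G g f \<in> span A"
    using right_translation_finite_span by blast
  show ?thesis
  proof (rule divisible_imp_unipotent[OF assms(1) A(1)])
    show "right_translation G g f \<in> span A" for g by (rule A(2))
    show "\<exists>h\<in>carrier (rational_points G). h [^]\<^bsub>rational_points G\<^esub> k = g"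
      if "g \<in> carrier (rational_points G)" "1 \<le> k" for g and k :: nat
    proof -
      have "g \<in> power_map G k ` carrier (rational_points G)"
        unfolding assms(2)[OF that(2)] by (rule that(1))
      then show ?thesis unfolding power_map_def by blast
    qed
  qed
qed

text \<open>The binomial expansion of \<open>(1 + D)\<^sup>k\<close> for the operator \<open>D\<close> that sends \<open>h\<close> to its translate minus \<open>h\<close>.\<close>

lemma right_translation_funpow:
  "(right_translation G g ^^ k) f =
    (\<Sum>j\<le>k. of_nat (k choose j) * ((\<lambda>h. right_translation G g h - h) ^^ j) f)"
proof -
  let ?R = "right_translation G g"
  define d where "d j = ((\<lambda>h. ?R h - h) ^^ j) f" for j
  interpret R: comm_ring_hom ?R by (rule comm_ring_hom_right_translation)
  have R: "?R (d j) = d (Suc j) + d j" for j by (simp add: d_def)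
  have "(?R ^^ k) f = (\<Sum>j\<le>k. of_nat (k choose j) * d j)"
  proof (induction k)
    case 0
    then show ?case by (simp add: d_def)
  next
    case (Suc k)
    have "(?R ^^ Suc k) f = (\<Sum>j\<le>k. of_nat (k choose j) * d (Suc j)) + (\<Sum>j\<le>k. of_nat (k choose j) * d j)"
      unfolding funpow.simps o_apply Suc R.hom_sum R.hom_mult R.hom_of_nat R distrib_left sum.distrib ..
    also have "(\<Sum>j\<le>k. of_nat (k choose j) * d j) = (\<Sum>j\<le>Suc k. of_nat (k choose j) * d j)"
      by (simp add: binomial_eq_0)
    also have "\<dots> = d 0 + (\<Sum>j\<le>k. of_nat (k choose Suc j) * d (Suc j))"
      by (subst sum.atMost_Suc_shift) simp
    finally have "(?R ^^ Suc k) f = d 0 + (\<Sum>j\<le>k. of_nat (Suc k choose Suc j) * d (Suc j))"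
      by (simp only: binomial_Suc_Suc of_nat_add distrib_right sum.distrib add_ac)
    also have "\<dots> = (\<Sum>j\<le>Suc k. of_nat (Suc k choose j) * d j)"
      by (subst sum.atMost_Suc_shift) (simp only: binomial_n_0 of_nat_1 mult_1)
    finally show ?case .
  qed
  then show ?thesis unfolding d_def .
qed

text \<open>If the characteristic is positive, then for this exponent \<open>k\<close> all binomial coefficients
  \<open>k choose j\<close> with \<open>0 < j < N\<close> vanish in \<open>F\<close>, so that translation by \<open>g\<^sup>k\<close> fixes the coordinate
  functions. In characteristic zero \<open>k = 0\<close>.\<close>

lemma pow_eq_one_if_unipotent:
  assumes g: "g \<in> carrier (rational_points G)"
    and unip: "\<And>i. ((\<lambda>h. right_translation G g h - h) ^^ N) (Var i) \<in> ideal_of G"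
  shows "g [^]\<^bsub>rational_points G\<^esub> (CHAR('a) * fact N) = \<one>\<^bsub>rational_points G\<^esub>"
proof -
  interpret representation_modulo "\<lambda>c h. Const c * h" "rational_points G" "ideal_of G" "right_translation G"
    by (rule representation_right_translation)
  interpret R: comm_ring_hom "right_translation G g" by (rule comm_ring_hom_right_translation)
  interpret C: comm_ring_hom "Const :: 'a \<Rightarrow> ('v, 'a) mpoly" by (rule comm_ring_hom_Const)
  let ?k = "CHAR('a) * fact N"
  let ?D = "\<lambda>h. right_translation G g h - h"
  show ?thesis
  proof (rule rational_point_eq_oneI)
    show "g [^]\<^bsub>rational_points G\<^esub> ?k \<in> carrier (rational_points G)" using g by simp
    fix i
    have high: "(?D ^^ j) (Var i) \<in> ideal_of G" if "N \<le> j" for j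
      using that
    proof (induction j rule: dec_induct)
      case (step j)
      then show ?case using ring_ideal_diff[OF ideal right_translation_ideal[OF g]] by simp
    qed (rule unip)
    \<comment> \<open>For \<open>0 < j < N\<close> the coefficient \<open>(k choose j) = (k / j) ((k - 1) choose (j - 1))\<close> is a
      multiple of the characteristic, because \<open>j\<close> divides \<open>N!\<close>.\<close>
    have "of_nat (?k choose j) * (?D ^^ j) (Var i) \<in> ideal_of G" if "0 < j" for j
    proof (cases "N \<le> j")
      case True
      then show ?thesis using ring_ideal_mult[OF ideal high] by blast
    next
      case False
      then have "j dvd fact N" using that by (intro dvd_fact) auto
      then obtain e where e: "fact N = j * e" by blast
      have "j * (?k choose j) = j * (CHAR('a) * e * ((?k - 1) choose (j - 1)))"
        using times_binomial_minus1_eq[OF that, of ?k] e by (simp add: mult_ac)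
      then have "CHAR('a) dvd (?k choose j)" using that by simp
      then have "of_nat (?k choose j) = (0 :: 'a)" by (simp add: of_nat_eq_0_iff_char_dvd)
      then have "of_nat (?k choose j) = (0 :: ('v, 'a) mpoly)"
        using C.hom_of_nat[of "?k choose j"] by simp
      then show ?thesis using ideal by (simp add: ring_ideal_iff)
    qed
    then have "(\<Sum>j\<in>{..?k} - {0}. of_nat (?k choose j) * (?D ^^ j) (Var i)) \<in> ideal_of G"
      by (intro ring_ideal_sum[OF ideal]) auto
    moreover have "(right_translation G g ^^ ?k) (Var i) =
        Var i + (\<Sum>j\<in>{..?k} - {0}. of_nat (?k choose j) * (?D ^^ j) (Var i))"
      unfolding right_translation_funpow by (subst sum.remove[of _ 0]) auto
    ultimately have "eqv ((right_translation G g ^^ ?k) (Var i)) (Var i)"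
      by (simp add: eqv_def)
    from eqv_trans[OF rho_pow[OF g] this]
    show "right_translation G (g [^]\<^bsub>rational_points G\<^esub> ?k) (Var i) - Var i \<in> ideal_of G"
      by (simp add: eqv_def)
  qed
qed

end

theorem corollary1p4:
  fixes v :: "'a::field \<Rightarrow> real"
    and G :: "('v::finite, 'a) affine_gs"
  assumes "nonarch_local_field v"
    and "algebraic_group G"
    and "\<And>k::nat. k \<ge> 1 \<Longrightarrow>
           power_map G k ` carrier (rational_points G) = carrier (rational_points G)"
  shows "unipotent_points G \<and>
         (CHAR('a) > 0 \<longrightarrow> carrier (rational_points G) = {\<one>\<^bsub>rational_points G\<^esub>})"
proof (intro conjI impI)
  interpret algebraic_group G by fact
  interpret \<Gamma>: group "rational_points G" by (rule group_rational_points)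
  note unip = divisible_uniformly_unipotent[OF assms(1,3)]
  show "unipotent_points G"
    using unip unfolding unipotent_points_def unipotent_element_def by blast
  assume char: "CHAR('a) > 0"
  from unip have "\<forall>i. \<exists>n. \<forall>g\<in>carrier (rational_points G).
      ((\<lambda>h. right_translation G g h - h) ^^ n) (Var i) \<in> ideal_of G"
    by (intro allI unip)
  then obtain n where n: "\<forall>i. \<forall>g\<in>carrier (rational_points G).
      ((\<lambda>h. right_translation G g h - h) ^^ n i) (Var i) \<in> ideal_of G"
    unfolding choice_iff by (elim exE) (rule that)
  define N where "N = Max (range n)"
  let ?k = "CHAR('a) * fact N"
  have one: "g [^]\<^bsub>rational_points G\<^esub> ?k = \<one>\<^bsub>rational_points G\<^esub>" if g: "g \<in> carrier (rational_points G)" for g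
  proof (rule pow_eq_one_if_unipotent[OF g])
    fix i
    have "n i \<le> N" unfolding N_def by (intro Max_ge) auto
    then show "((\<lambda>h. right_translation G g h - h) ^^ N) (Var i) \<in> ideal_of G"
    proof (induction rule: dec_induct)
      case (step j)
      then show ?case using ring_ideal_diff[OF ideal right_translation_ideal[OF g]] by simp
    qed (use n g in blast)
  qed
  have "1 \<le> ?k" using char by (simp add: Suc_le_eq)
  from assms(3)[OF this] have "carrier (rational_points G) = power_map G ?k ` carrier (rational_points G)" ..
  also have "\<dots> = (\<lambda>_. \<one>\<^bsub>rational_points G\<^esub>) ` carrier (rational_points G)"
    unfolding power_map_def using one by (rule image_cong[OF refl])
  also have "\<dots> = {\<one>\<^bsub>rational_points G\<^esub>}" using \<Gamma>.one_closed by blast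
  finally show "carrier (rational_points G) = {\<one>\<^bsub>rational_points G\<^esub>}" .
qed

end
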